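(* Let $V$ be a vocabulary with at most countably many predicate and function symbols, let $\upsilon$ be an inaccessible cardinal greater than $|V|+\aleph_0$, let $\mathbb K$ be a first-order positive monster structure with universe $M$ whose vocabulary $W$ contains at least all the function and constant symbols of $V$, and let $\mathbf I$ be a positive interpretation of $V$ in $\mathbb K$. There is a unique $V$-structure $\mathbb M=\mathbf I(\mathbb K)$ with universe $M$ such that $\mathbb M$ agrees with $\mathbb K$ on all function and constant symbols in $V$, and for each $k$-ary predicate symbol $P\in V$, each dyadic rational $r\in[0,1]$, and each $\vec b\in M^k$, $$P^{\mathbb M}(\vec b)\in[0,r]\ \text{ if and only if }\ \mathbb K\models\bigwedge_{s>r}\mathbf I(P,[0,s])(\vec b)$$ and $$P^{\mathbb M}(\vec b)\in[r,1]\ \text{ if and only if }\ \mathbb K\models\bigwedge_{s<r}\mathbf I(P,[s,1])(\vec b),$$ where $s$ ranges over dyadic rationals in $[0,1]$ and the empty conjunction is the true sentence. Moreover, $\mathbb M$ is a monster structure (that is, a reduced $\upsilon$-saturated structure of cardinality $\upsilon$), and for each infinite cardinal $\lambda$, if $\mathbb K$ is positively $\lambda$-stable then $\mathbb M$ is $\lambda$-stable.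
   Context: First-order side: a first-order formula is positive if it is built from atomic formulas using only quantifiers and the connectives $\wedge,\vee$. A first-order structure is positively $\kappa$-saturated if every set of positive formulas with free variable $x$ and fewer than $\kappa$ parameters that is finitely satisfiable in the structure is satisfiable in it. A positive monster structure is a positively $\upsilon$-saturated first-order structure of cardinality $\upsilon$. In a positive monster structure $\mathbb K$, the complete positive type of a tuple $\vec b$ over $A$ is the set of all positive formulas $\varphi(\vec x)$ with parameters in $A$ satisfied by $\vec b$. $\mathbb K$ is positively $\lambda$-stable if it is a positive monster structure and for every set $A$ of cardinality $\lambda$ the set of complete positive $1$-types over $A$ in $\mathbb K$ has cardinality $\le\lambda$. A $\bigwedge$-formula is a finite or countable conjunction of positive formulas, possibly with parameters in $\mathbb K$ (the empty conjunction, always true, is allowed). Let $\mathbb D$ be the set of dyadic rationals in $[0,1]$ and $\mathbb J$ the set of all intervals $[0,r]$ or $[r,1]$ with $r\in\mathbb D$. A positive interpretation of $V$ in $\mathbb K$ is a function $\mathbf I$ that associates with each $k$-ary predicate symbol $P\in V$ and $J\in\mathbb J$ a $\bigwedge$-formula $\mathbf I(P,J)$ in the vocabulary $W$ with $k$ free variables, such that whenever $r<s$ in $\mathbb D$ (superscript $\mathbb K$ denotes the subset of $M^k$ defined in $\mathbb K$): (a) $\mathbf I(P,[0,r])^{\mathbb K}\subseteq\mathbf I(P,[0,s])^{\mathbb K}$ and $\mathbf I(P,[r,1])^{\mathbb K}\supseteq\mathbf I(P,[s,1])^{\mathbb K}$; (b) $\mathbf I(P,[0,r])^{\mathbb K}\cap\mathbf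 I(P,[s,1])^{\mathbb K}=\emptyset$; (c) $\mathbf I(P,[r,1])^{\mathbb K}\cup\mathbf I(P,[0,s])^{\mathbb K}=M^k$. $[0,1]$-valued side: a vocabulary $V$ consists of finitary predicate and function symbols and constant symbols (no equality). A $V$-structure (general structure) $\mathbb M$ with universe $M$ has $c^{\mathbb M}\in M$, $F^{\mathbb M}:M^n\to M$, $P^{\mathbb M}:M^n\to[0,1]$. $V$-formulas are built from atomic formulas $P(t_1,\dots,t_n)$ using all continuous connectives $[0,1]^n\to[0,1]$, $n\ge0$, and the quantifiers $\sup_x,\inf_x$, with truth values in $[0,1]$ defined as usual, $0$ being truth; $\vec b$ satisfies $\varphi$ if $\varphi^{\mathbb M}(\vec b)=0$. $\mathbb M$ is reduced if, for all $a,b\in M$, whenever $\varphi^{\mathbb M}(a,\vec c)=\varphi^{\mathbb M}(b,\vec c)$ for every atomic formula $\varphi(x,\vec z)$ and every tuple $\vec c$ in $M$, then $a=b$. $\mathbb M$ is $\kappa$-saturated if for each $A\subseteq M$ with $|A|<\kappa$, every set of formulas in one free variable with parameters from $A$ that is finitely satisfiable in $\mathbb M$ is satisfiable in $\mathbb M$. A monster structure is a reduced $\upsilon$-saturated structure of cardinality $\upsilon$. $\mathrm{tp}_{\mathbb M}(b/A)$ is the set of formulas with parameters in $A$ satisfied by $b$, and $S_1^{\mathbb M}(A)$ is the set of complete $1$-types over $A$, i.e. those realized in models of the complete theory of $\mathbb M$ with constants for the elements of $A$. Small means of cardinality $<\upsilon$. The topology of $\mathbb M$ is the one whose closed sets are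 the sets $\{c\in M:\ \varphi^{\mathbb M}(c)=0 \text{ for all }\varphi\in\Phi\}$, $\Phi(x)$ a set of $V$-formulas with parameters in $M$. A monster structure $\mathbb M$ is $\lambda$-stable if for each small $A$ with $|A|\le\lambda$ there is a set $B\subseteq S_1^{\mathbb M}(A)$ with $|B|\le\lambda$ such that $\{b\in M:\mathrm{tp}_{\mathbb M}(b/A)\in B\}$ is dense in $\mathbb M$.
   Formalization: That M is reduced is not concluded, since it can fail (e.g. when V has no predicate symbols); υ-saturation, cardinality υ and the density condition of λ-stability are proved for every such M, and M is a monster structure whenever it is reduced. *)

theory Defs
  imports "HOL-Analysis.Analysis"
begin

unbundle cardinal_syntax
no_notation elt_set_eq (infix "=o" 50)

section \<open>Vocabularies, structures and terms\<close>

record ('f, 'c, 'p) vocab =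
  psyms :: "'p set"
  arity :: "'p \<Rightarrow> nat"
  fsyms :: "'f set"
  farity :: "'f \<Rightarrow> nat"
  csyms :: "'c set"

abbreviation symbols :: "('f, 'c, 'p) vocab \<Rightarrow> ('p + ('f + 'c)) set" where
  "symbols V \<equiv> psyms V <+> (fsyms V <+> csyms V)"

definition tuples :: "nat \<Rightarrow> 'm list set" where
  "tuples k = {b. length b = k}"

text \<open>
  The universe of a structure is the whole type \<open>'m\<close>. The value type \<open>'v\<close> is \<open>bool\<close> for
  first-order structures and \<open>real\<close> for \<open>[0,1]\<close>-valued ones. In \<open>is_struct\<close>, the extensional
  function spaces fix the junk values outside the vocabulary, so that two structures on \<open>'m\<close>
  with the same interpretations of all symbols are equal.
\<close>

record ('f, 'c, 'p, 'm, 'v) struct =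
  cst :: "'c \<Rightarrow> 'm"
  fn :: "'f \<Rightarrow> 'm list \<Rightarrow> 'm"
  pr :: "'p \<Rightarrow> 'm list \<Rightarrow> 'v"

definition is_struct ::
  "('f, 'c, 'p) vocab \<Rightarrow> 'v set \<Rightarrow> ('f, 'c, 'p, 'm, 'v) struct \<Rightarrow> bool" where
  "is_struct V D S \<longleftrightarrow>
     cst S \<in> csyms V \<rightarrow>\<^sub>E UNIV \<and>
     fn S \<in> (\<Pi>\<^sub>E F\<in>fsyms V. tuples (farity V F) \<rightarrow>\<^sub>E UNIV) \<and>
     pr S \<in> (\<Pi>\<^sub>E P\<in>psyms V. tuples (arity V P) \<rightarrow>\<^sub>E D)"

text \<open>
  Terms may contain parameters \<open>Par a\<close>, which act as additional constant symbols; their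
  interpretation \<open>e\<close> is an argument of the evaluation functions (the identity for parameters
  taken from the structure itself).
\<close>

datatype ('f, 'c, 'a) tm =
  Var nat
| Cst 'c
| Par 'a
| App 'f "('f, 'c, 'a) tm list"

fun tm_fv :: "('f, 'c, 'a) tm \<Rightarrow> nat set" where
  "tm_fv (Var x) = {x}"
| "tm_fv (Cst c) = {}"
| "tm_fv (Par a) = {}"
| "tm_fv (App F ts) = (\<Union>t\<in>set ts. tm_fv t)"

fun tm_params :: "('f, 'c, 'a) tm \<Rightarrow> 'a set" where
  "tm_params (Var x) = {}"
| "tm_params (Cst c) = {}"
| "tm_params (Par a) = {a}"
| "tm_params (App F ts) = (\<Union>t\<in>set ts. tm_params t)"

fun tm_wf :: "('f, 'c, 'p) vocab \<Rightarrow> ('f, 'c, 'a) tm \<Rightarrow> bool" where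
  "tm_wf V (Var x) \<longleftrightarrow> True"
| "tm_wf V (Cst c) \<longleftrightarrow> c \<in> csyms V"
| "tm_wf V (Par a) \<longleftrightarrow> True"
| "tm_wf V (App F ts) \<longleftrightarrow> F \<in> fsyms V \<and> length ts = farity V F \<and> (\<forall>t\<in>set ts. tm_wf V t)"

fun tm_val :: "('f, 'c, 'p, 'm, 'v) struct \<Rightarrow> ('a \<Rightarrow> 'm) \<Rightarrow> (nat \<Rightarrow> 'm) \<Rightarrow>
    ('f, 'c, 'a) tm \<Rightarrow> 'm" where
  "tm_val S e \<sigma> (Var x) = \<sigma> x"
| "tm_val S e \<sigma> (Cst c) = cst S c"
| "tm_val S e \<sigma> (Par a) = e a"
| "tm_val S e \<sigma> (App F ts) = fn S F (map (tm_val S e \<sigma>) ts)"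

section \<open>First-order formulas and positive saturation\<close>

datatype ('f, 'c, 'p, 'a) fo =
  Eq "('f, 'c, 'a) tm" "('f, 'c, 'a) tm"
| Rel 'p "('f, 'c, 'a) tm list"
| Neg "('f, 'c, 'p, 'a) fo"
| Conj "('f, 'c, 'p, 'a) fo" "('f, 'c, 'p, 'a) fo"
| Disj "('f, 'c, 'p, 'a) fo" "('f, 'c, 'p, 'a) fo"
| All nat "('f, 'c, 'p, 'a) fo"
| Ex nat "('f, 'c, 'p, 'a) fo"

primrec positive :: "('f, 'c, 'p, 'a) fo \<Rightarrow> bool" where
  "positive (Eq s t) \<longleftrightarrow> True"
| "positive (Rel P ts) \<longleftrightarrow> True"
| "positive (Neg \<phi>) \<longleftrightarrow> False"
| "positive (Conj \<phi> \<psi>) \<longleftrightarrow> positive \<phi> \<and> positive \<psi>"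
| "positive (Disj \<phi> \<psi>) \<longleftrightarrow> positive \<phi> \<and> positive \<psi>"
| "positive (All x \<phi>) \<longleftrightarrow> positive \<phi>"
| "positive (Ex x \<phi>) \<longleftrightarrow> positive \<phi>"

primrec fo_fv :: "('f, 'c, 'p, 'a) fo \<Rightarrow> nat set" where
  "fo_fv (Eq s t) = tm_fv s \<union> tm_fv t"
| "fo_fv (Rel P ts) = (\<Union>t\<in>set ts. tm_fv t)"
| "fo_fv (Neg \<phi>) = fo_fv \<phi>"
| "fo_fv (Conj \<phi> \<psi>) = fo_fv \<phi> \<union> fo_fv \<psi>"
| "fo_fv (Disj \<phi> \<psi>) = fo_fv \<phi> \<union> fo_fv \<psi>"
| "fo_fv (All x \<phi>) = fo_fv \<phi> - {x}"
| "fo_fv (Ex x \<phi>) = fo_fv \<phi> - {x}"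

primrec fo_params :: "('f, 'c, 'p, 'a) fo \<Rightarrow> 'a set" where
  "fo_params (Eq s t) = tm_params s \<union> tm_params t"
| "fo_params (Rel P ts) = (\<Union>t\<in>set ts. tm_params t)"
| "fo_params (Neg \<phi>) = fo_params \<phi>"
| "fo_params (Conj \<phi> \<psi>) = fo_params \<phi> \<union> fo_params \<psi>"
| "fo_params (Disj \<phi> \<psi>) = fo_params \<phi> \<union> fo_params \<psi>"
| "fo_params (All x \<phi>) = fo_params \<phi>"
| "fo_params (Ex x \<phi>) = fo_params \<phi>"

primrec fo_wf :: "('f, 'c, 'p) vocab \<Rightarrow> ('f, 'c, 'p, 'a) fo \<Rightarrow> bool" where
  "fo_wf W (Eq s t) \<longleftrightarrow> tm_wf W s \<and> tm_wf W t"
| "fo_wf W (Rel P ts) \<longleftrightarrow> P \<in> psyms W \<and> length ts = arity W P \<and> (\<forall>t\<in>set ts. tm_wf W t)"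
| "fo_wf W (Neg \<phi>) \<longleftrightarrow> fo_wf W \<phi>"
| "fo_wf W (Conj \<phi> \<psi>) \<longleftrightarrow> fo_wf W \<phi> \<and> fo_wf W \<psi>"
| "fo_wf W (Disj \<phi> \<psi>) \<longleftrightarrow> fo_wf W \<phi> \<and> fo_wf W \<psi>"
| "fo_wf W (All x \<phi>) \<longleftrightarrow> fo_wf W \<phi>"
| "fo_wf W (Ex x \<phi>) \<longleftrightarrow> fo_wf W \<phi>"

primrec sat :: "('f, 'c, 'p, 'm, bool) struct \<Rightarrow> ('a \<Rightarrow> 'm) \<Rightarrow> (nat \<Rightarrow> 'm) \<Rightarrow>
    ('f, 'c, 'p, 'a) fo \<Rightarrow> bool" where
  "sat K e \<sigma> (Eq s t) \<longleftrightarrow> tm_val K e \<sigma> s = tm_val K e \<sigma> t"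
| "sat K e \<sigma> (Rel P ts) \<longleftrightarrow> pr K P (map (tm_val K e \<sigma>) ts)"
| "sat K e \<sigma> (Neg \<phi>) \<longleftrightarrow> \<not> sat K e \<sigma> \<phi>"
| "sat K e \<sigma> (Conj \<phi> \<psi>) \<longleftrightarrow> sat K e \<sigma> \<phi> \<and> sat K e \<sigma> \<psi>"
| "sat K e \<sigma> (Disj \<phi> \<psi>) \<longleftrightarrow> sat K e \<sigma> \<phi> \<or> sat K e \<sigma> \<psi>"
| "sat K e \<sigma> (All x \<phi>) \<longleftrightarrow> (\<forall>a. sat K e (\<sigma>(x := a)) \<phi>)"
| "sat K e \<sigma> (Ex x \<phi>) \<longleftrightarrow> (\<exists>a. sat K e (\<sigma>(x := a)) \<phi>)"

text \<open>
  The free variable of a formula in one variable is variable \<open>0\<close>; since no other variable is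
  free in it, the constant assignment \<open>\<lambda>_. b\<close> evaluates it at \<open>b\<close>.
\<close>

definition positively_saturated ::
  "'u rel \<Rightarrow> ('f, 'c, 'p) vocab \<Rightarrow> ('f, 'c, 'p, 'm, bool) struct \<Rightarrow> bool" where
  "positively_saturated \<kappa> W K \<longleftrightarrow>
     (\<forall>\<Phi> :: ('f, 'c, 'p, 'm) fo set.
        (\<forall>\<phi>\<in>\<Phi>. fo_wf W \<phi> \<and> positive \<phi> \<and> fo_fv \<phi> \<subseteq> {0}) \<and>
        |\<Union>\<phi>\<in>\<Phi>. fo_params \<phi>| <o \<kappa> \<and>
        (\<forall>\<Psi>\<subseteq>\<Phi>. finite \<Psi> \<longrightarrow> (\<exists>b. \<forall>\<phi>\<in>\<Psi>. sat K id (\<lambda>_. b) \<phi>)) \<longrightarrow>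
        (\<exists>b. \<forall>\<phi>\<in>\<Phi>. sat K id (\<lambda>_. b) \<phi>))"

definition positive_monster ::
  "'u rel \<Rightarrow> ('f, 'c, 'p) vocab \<Rightarrow> ('f, 'c, 'p, 'm, bool) struct \<Rightarrow> bool" where
  "positive_monster \<upsilon> W K \<longleftrightarrow>
     is_struct W UNIV K \<and> positively_saturated \<upsilon> W K \<and> |UNIV :: 'm set| =o \<upsilon>"

definition positive_type :: "('f, 'c, 'p) vocab \<Rightarrow> ('f, 'c, 'p, 'm, bool) struct \<Rightarrow>
    'm set \<Rightarrow> 'm \<Rightarrow> ('f, 'c, 'p, 'm) fo set" where
  "positive_type W K A b =
     {\<phi>. fo_wf W \<phi> \<and> positive \<phi> \<and> fo_fv \<phi> \<subseteq> {0} \<and> fo_params \<phi> \<subseteq> A \<and> sat K id (\<lambda>_. b) \<phi>}"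

definition positively_stable ::
  "'u rel \<Rightarrow> 'l rel \<Rightarrow> ('f, 'c, 'p) vocab \<Rightarrow> ('f, 'c, 'p, 'm, bool) struct \<Rightarrow> bool" where
  "positively_stable \<upsilon> l W K \<longleftrightarrow>
     positive_monster \<upsilon> W K \<and>
     (\<forall>A :: 'm set. |A| =o l \<longrightarrow> |range (positive_type W K A)| \<le>o l)"

section \<open>Positive interpretations\<close>

definition dyadic :: "real set" where
  "dyadic = {r. 0 \<le> r \<and> r \<le> 1 \<and> (\<exists>(k::nat) (n::nat). r = real k / 2 ^ n)}"

definition dyadic_intervals :: "real set set" where
  "dyadic_intervals = (\<lambda>r. {0..r}) ` dyadic \<union> (\<lambda>r. {r..1}) ` dyadic"

text \<open>A countable conjunction is represented by the set of its conjuncts.\<close>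

definition wedge_formula :: "('f, 'c, 'p) vocab \<Rightarrow> nat \<Rightarrow> ('f, 'c, 'p, 'a) fo set \<Rightarrow> bool" where
  "wedge_formula W k \<Phi> \<longleftrightarrow>
     countable \<Phi> \<and> (\<forall>\<phi>\<in>\<Phi>. fo_wf W \<phi> \<and> positive \<phi> \<and> fo_fv \<phi> \<subseteq> {..<k})"

definition defset :: "('f, 'c, 'p, 'm, bool) struct \<Rightarrow> nat \<Rightarrow> ('f, 'c, 'p, 'm) fo set \<Rightarrow>
    'm list set" where
  "defset K k \<Phi> = {b \<in> tuples k. \<forall>\<phi>\<in>\<Phi>. sat K id (\<lambda>i. b ! i) \<phi>}"

definition positive_interpretation :: "('f, 'c, 'p) vocab \<Rightarrow> ('g, 'd, 'q) vocab \<Rightarrow>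
    ('g, 'd, 'q, 'm, bool) struct \<Rightarrow> ('p \<Rightarrow> real set \<Rightarrow> ('g, 'd, 'q, 'm) fo set) \<Rightarrow> bool" where
  "positive_interpretation V W K I \<longleftrightarrow>
     (\<forall>P\<in>psyms V.
        (\<forall>J\<in>dyadic_intervals. wedge_formula W (arity V P) (I P J)) \<and>
        (\<forall>r\<in>dyadic. \<forall>s\<in>dyadic. r < s \<longrightarrow>
           defset K (arity V P) (I P {0..r}) \<subseteq> defset K (arity V P) (I P {0..s}) \<and>
           defset K (arity V P) (I P {r..1}) \<supseteq> defset K (arity V P) (I P {s..1}) \<and>
           defset K (arity V P) (I P {0..r}) \<inter> defset K (arity V P) (I P {s..1}) = {} \<and>
           defset K (arity V P) (I P {r..1}) \<union> defset K (arity V P) (I P {0..s})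
             = tuples (arity V P)))"

section \<open>Formulas with values in the unit interval\<close>

datatype ('f, 'c, 'p, 'a) fm =
  Pred 'p "('f, 'c, 'a) tm list"
| Conn "(nat \<Rightarrow> real) \<Rightarrow> real" "('f, 'c, 'p, 'a) fm list"
| SupQ nat "('f, 'c, 'p, 'a) fm"
| InfQ nat "('f, 'c, 'p, 'a) fm"

text \<open>
  An \<open>n\<close>-ary connective is a continuous map on the \<open>n\<close>-fold product of \<open>[0,1]\<close>, whose points
  are the extensional functions on \<open>{..<n}\<close>.
\<close>

definition connective :: "nat \<Rightarrow> ((nat \<Rightarrow> real) \<Rightarrow> real) \<Rightarrow> bool" where
  "connective n C \<longleftrightarrow>
     continuous_map (product_topology (\<lambda>_. top_of_set {0..1}) {..<n}) (top_of_set {0..1}) C"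

fun fm_fv :: "('f, 'c, 'p, 'a) fm \<Rightarrow> nat set" where
  "fm_fv (Pred P ts) = (\<Union>t\<in>set ts. tm_fv t)"
| "fm_fv (Conn C \<phi>s) = (\<Union>\<phi>\<in>set \<phi>s. fm_fv \<phi>)"
| "fm_fv (SupQ x \<phi>) = fm_fv \<phi> - {x}"
| "fm_fv (InfQ x \<phi>) = fm_fv \<phi> - {x}"

fun fm_params :: "('f, 'c, 'p, 'a) fm \<Rightarrow> 'a set" where
  "fm_params (Pred P ts) = (\<Union>t\<in>set ts. tm_params t)"
| "fm_params (Conn C \<phi>s) = (\<Union>\<phi>\<in>set \<phi>s. fm_params \<phi>)"
| "fm_params (SupQ x \<phi>) = fm_params \<phi>"
| "fm_params (InfQ x \<phi>) = fm_params \<phi>"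

fun fm_wf :: "('f, 'c, 'p) vocab \<Rightarrow> ('f, 'c, 'p, 'a) fm \<Rightarrow> bool" where
  "fm_wf V (Pred P ts) \<longleftrightarrow> P \<in> psyms V \<and> length ts = arity V P \<and> (\<forall>t\<in>set ts. tm_wf V t)"
| "fm_wf V (Conn C \<phi>s) \<longleftrightarrow> connective (length \<phi>s) C \<and> (\<forall>\<phi>\<in>set \<phi>s. fm_wf V \<phi>)"
| "fm_wf V (SupQ x \<phi>) \<longleftrightarrow> fm_wf V \<phi>"
| "fm_wf V (InfQ x \<phi>) \<longleftrightarrow> fm_wf V \<phi>"

fun val :: "('f, 'c, 'p, 'm, real) struct \<Rightarrow> ('a \<Rightarrow> 'm) \<Rightarrow> (nat \<Rightarrow> 'm) \<Rightarrow>
    ('f, 'c, 'p, 'a) fm \<Rightarrow> real" where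
  "val M e \<sigma> (Pred P ts) = pr M P (map (tm_val M e \<sigma>) ts)"
| "val M e \<sigma> (Conn C \<phi>s) = C (\<lambda>i\<in>{..<length \<phi>s}. map (val M e \<sigma>) \<phi>s ! i)"
| "val M e \<sigma> (SupQ x \<phi>) = (SUP a. val M e (\<sigma>(x := a)) \<phi>)"
| "val M e \<sigma> (InfQ x \<phi>) = (INF a. val M e (\<sigma>(x := a)) \<phi>)"

definition fms1 :: "('f, 'c, 'p) vocab \<Rightarrow> 'a set \<Rightarrow> ('f, 'c, 'p, 'a) fm set" where
  "fms1 V A = {\<phi>. fm_wf V \<phi> \<and> fm_fv \<phi> \<subseteq> {0} \<and> fm_params \<phi> \<subseteq> A}"

abbreviation is_general_struct ::
  "('f, 'c, 'p) vocab \<Rightarrow> ('f, 'c, 'p, 'm, real) struct \<Rightarrow> bool" where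
  "is_general_struct V M \<equiv> is_struct V {0..1} M"

definition is_reduced :: "('f, 'c, 'p) vocab \<Rightarrow> ('f, 'c, 'p, 'm, real) struct \<Rightarrow> bool" where
  "is_reduced V M \<longleftrightarrow>
     (\<forall>a b. (\<forall>P ts \<sigma>. fm_wf V (Pred P ts :: ('f, 'c, 'p, 'm) fm) \<and> fm_params (Pred P ts) = {} \<longrightarrow>
               val M id (\<sigma>(0 := a)) (Pred P ts) = val M id (\<sigma>(0 := b)) (Pred P ts)) \<longrightarrow>
            a = b)"

definition saturated ::
  "'u rel \<Rightarrow> ('f, 'c, 'p) vocab \<Rightarrow> ('f, 'c, 'p, 'm, real) struct \<Rightarrow> bool" where
  "saturated \<kappa> V M \<longleftrightarrow>
     (\<forall>A :: 'm set. |A| <o \<kappa> \<longrightarrow>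
        (\<forall>\<Phi>\<subseteq>fms1 V A.
           (\<forall>\<Psi>\<subseteq>\<Phi>. finite \<Psi> \<longrightarrow> (\<exists>b. \<forall>\<phi>\<in>\<Psi>. val M id (\<lambda>_. b) \<phi> = 0)) \<longrightarrow>
           (\<exists>b. \<forall>\<phi>\<in>\<Phi>. val M id (\<lambda>_. b) \<phi> = 0)))"

definition monster ::
  "'u rel \<Rightarrow> ('f, 'c, 'p) vocab \<Rightarrow> ('f, 'c, 'p, 'm, real) struct \<Rightarrow> bool" where
  "monster \<upsilon> V M \<longleftrightarrow>
     is_general_struct V M \<and> is_reduced V M \<and> saturated \<upsilon> V M \<and> |UNIV :: 'm set| =o \<upsilon>"

text \<open>
  Saturation and cardinality of a structure do not make it reduced, and neither does being
  given by an interpretation of \<open>V\<close>: all predicates of \<open>V\<close> may be interpreted by constants,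
  and without predicates a reduced structure has only one element.
\<close>

lemma is_reduced_no_predicates:
  fixes M :: "('f, 'c, 'p, 'm, real) struct"
  assumes "psyms V = {}"
  shows "is_reduced V M \<longleftrightarrow> (\<forall>a b :: 'm. a = b)"
  using assms by (simp add: is_reduced_def)

section \<open>Types, topology and stability\<close>

definition tp :: "('f, 'c, 'p) vocab \<Rightarrow> ('f, 'c, 'p, 'm, real) struct \<Rightarrow> ('a \<Rightarrow> 'm) \<Rightarrow>
    'a set \<Rightarrow> 'm \<Rightarrow> ('f, 'c, 'p, 'a) fm set" where
  "tp V M e A b = {\<phi> \<in> fms1 V A. val M e (\<lambda>_. b) \<phi> = 0}"

text \<open>\<open>theory_of V M A\<close> is the complete theory of \<open>M\<close> with constants for the elements of \<open>A\<close>.\<close>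

definition theory_of :: "('f, 'c, 'p) vocab \<Rightarrow> ('f, 'c, 'p, 'm, real) struct \<Rightarrow>
    'm set \<Rightarrow> ('f, 'c, 'p, 'm) fm set" where
  "theory_of V M A =
     {\<phi>. fm_wf V \<phi> \<and> fm_fv \<phi> = {} \<and> fm_params \<phi> \<subseteq> A \<and> (\<forall>\<sigma>. val M id \<sigma> \<phi> = 0)}"

text \<open>
  In the space of complete 1-types over \<open>A\<close>, the models \<open>N\<close> of the theory have universe \<open>'m\<close>,
  since one cannot quantify over types. In a saturated \<open>M\<close> nothing is lost: for small \<open>A\<close>,
  every type realized in some model, of any cardinality, is already realized in \<open>M\<close>.
\<close>

definition types1 :: "('f, 'c, 'p) vocab \<Rightarrow> ('f, 'c, 'p, 'm, real) struct \<Rightarrow>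
    'm set \<Rightarrow> ('f, 'c, 'p, 'm) fm set set" where
  "types1 V M A =
     {tp V N e A b | (N :: ('f, 'c, 'p, 'm, real) struct) e b.
        is_general_struct V N \<and> (\<forall>\<phi>\<in>theory_of V M A. \<forall>\<sigma>. val N e \<sigma> \<phi> = 0)}"

definition zeros :: "('f, 'c, 'p, 'm, real) struct \<Rightarrow> ('f, 'c, 'p, 'm) fm set \<Rightarrow> 'm set" where
  "zeros M \<Phi> = {c. \<forall>\<phi>\<in>\<Phi>. val M id (\<lambda>_. c) \<phi> = 0}"

definition struct_topology ::
  "('f, 'c, 'p) vocab \<Rightarrow> ('f, 'c, 'p, 'm, real) struct \<Rightarrow> 'm topology" where
  "struct_topology V M = topology (\<lambda>U. \<exists>\<Phi>\<subseteq>fms1 V UNIV. U = - zeros M \<Phi>)"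

text \<open>
  The family of complements of zero sets is indeed a topology: the minimum connective gives
  closure under finite intersections.
\<close>

lemma connective_const: "c \<in> {0..1} \<Longrightarrow> connective n (\<lambda>_. c)"
  by (simp add: connective_def)

lemma connective_min: "connective 2 (\<lambda>x. min (x 0) (x 1))"
proof -
  let ?X = "product_topology (\<lambda>_::nat. top_of_set {0..1::real}) {..<2}"
  have proj: "continuous_map ?X (top_of_set {0..1::real}) (\<lambda>x. x i)" if "i < 2" for i
    using continuous_map_product_projection[of i "{..<2}" "\<lambda>_::nat. top_of_set {0..1::real}"] that
    by simp
  have "continuous_map ?X euclideanreal (\<lambda>x. min (x 0) (x 1))"
    by (intro continuous_map_real_min continuous_map_into_fulltopology[OF proj]) auto
  moreover have "(\<lambda>x. min (x 0) (x 1)) \<in> topspace ?X \<rightarrow> {0..1}"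
    by (auto simp: PiE_iff min_def)
  ultimately show ?thesis
    by (simp add: connective_def continuous_map_in_subtopology image_subset_iff_funcset)
qed

lemma connective_range:
  assumes "connective n C" and "\<And>i. i < n \<Longrightarrow> x i \<in> {0..1}"
  shows "C (\<lambda>i\<in>{..<n}. x i) \<in> {0..1}"
proof -
  have "(\<lambda>i\<in>{..<n}. x i) \<in> topspace (product_topology (\<lambda>_. top_of_set {0..1::real}) {..<n})"
    using assms(2) by auto
  moreover have "C \<in> topspace (product_topology (\<lambda>_. top_of_set {0..1::real}) {..<n}) \<rightarrow> {0..1}"
    using continuous_map_funspace[OF assms(1)[unfolded connective_def]] by simp
  ultimately show ?thesis
    by (rule funcset_mem[rotated])
qed

lemma val_range:
  assumes "is_general_struct V M"
  shows "fm_wf V \<phi> \<Longrightarrow> val M e \<sigma> \<phi> \<in> {0..1}"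
proof (induction \<phi> arbitrary: \<sigma>)
  case (Pred P ts)
  then have "pr M P \<in> tuples (arity V P) \<rightarrow>\<^sub>E {0..1}"
    and "map (tm_val M e \<sigma>) ts \<in> tuples (arity V P)"
    using assms unfolding is_struct_def tuples_def by (auto dest: PiE_mem)
  then show ?case
    by (simp only: val.simps) (rule PiE_mem)
next
  case (Conn C \<phi>s)
  have "C (\<lambda>i\<in>{..<length \<phi>s}. map (val M e \<sigma>) \<phi>s ! i) \<in> {0..1}"
  proof (rule connective_range)
    show "connective (length \<phi>s) C" using Conn.prems by simp
    show "map (val M e \<sigma>) \<phi>s ! i \<in> {0..1}" if "i < length \<phi>s" for i
      using Conn.IH[of "\<phi>s ! i"] Conn.prems that by simp
  qed
  then show ?case by (simp only: val.simps)
next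
  case (SupQ x \<phi>)
  then have *: "val M e (\<sigma>(x := a)) \<phi> \<in> {0..1}" for a by simp
  have "(SUP a. val M e (\<sigma>(x := a)) \<phi>) \<le> 1"
    by (rule cSUP_least) (use * in simp_all)
  moreover have "bdd_above (range (\<lambda>a. val M e (\<sigma>(x := a)) \<phi>))"
    by (rule bdd_aboveI[of _ 1]) (use * in fastforce)
  then have "val M e (\<sigma>(x := undefined)) \<phi> \<le> (SUP a. val M e (\<sigma>(x := a)) \<phi>)"
    by (rule cSUP_upper[OF UNIV_I])
  moreover have "0 \<le> val M e (\<sigma>(x := undefined)) \<phi>"
    using *[of undefined] by simp
  ultimately show ?case by simp
next
  case (InfQ x \<phi>)
  then have *: "val M e (\<sigma>(x := a)) \<phi> \<in> {0..1}" for a by simp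
  have "0 \<le> (INF a. val M e (\<sigma>(x := a)) \<phi>)"
    by (rule cINF_greatest) (use * in simp_all)
  moreover have "bdd_below (range (\<lambda>a. val M e (\<sigma>(x := a)) \<phi>))"
    by (rule bdd_belowI[of _ 0]) (use * in fastforce)
  then have "(INF a. val M e (\<sigma>(x := a)) \<phi>) \<le> val M e (\<sigma>(x := undefined)) \<phi>"
    by (rule cINF_lower[OF _ UNIV_I])
  moreover have "val M e (\<sigma>(x := undefined)) \<phi> \<le> 1"
    using *[of undefined] by simp
  ultimately show ?case by simp
qed

lemma istopology_zeros:
  fixes M :: "('f, 'c, 'p, 'm, real) struct"
  assumes M: "is_general_struct V M"
  shows "istopology (\<lambda>U. \<exists>\<Phi>\<subseteq>fms1 V UNIV. U = - zeros M \<Phi>)"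
  unfolding istopology_def
proof safe
  fix \<Phi> \<Psi> :: "('f, 'c, 'p, 'm) fm set"
  assume \<Phi>: "\<Phi> \<subseteq> fms1 V UNIV" and \<Psi>: "\<Psi> \<subseteq> fms1 V UNIV"
  define m :: "('f, 'c, 'p, 'm) fm \<Rightarrow> ('f, 'c, 'p, 'm) fm \<Rightarrow> ('f, 'c, 'p, 'm) fm"
    where "m = (\<lambda>\<phi> \<psi>. Conn (\<lambda>x. min (x 0) (x 1)) [\<phi>, \<psi>])"
  have val_m: "val M id \<sigma> (m \<phi> \<psi>) = min (val M id \<sigma> \<phi>) (val M id \<sigma> \<psi>)" for \<phi> \<psi> \<sigma>
    by (simp add: m_def)
  have nonneg: "val M id \<sigma> \<phi> \<ge> 0" if "\<phi> \<in> fms1 V UNIV" for \<phi> \<sigma>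
    using val_range[OF M, of \<phi> id \<sigma>] that by (simp add: fms1_def)
  have zero_m: "val M id \<sigma> (m \<phi> \<psi>) = 0 \<longleftrightarrow> val M id \<sigma> \<phi> = 0 \<or> val M id \<sigma> \<psi> = 0"
    if "\<phi> \<in> \<Phi>" "\<psi> \<in> \<Psi>" for \<phi> \<psi> \<sigma>
    using nonneg[of \<phi> \<sigma>] nonneg[of \<psi> \<sigma>] that \<Phi> \<Psi> unfolding val_m by (auto simp: min_def)
  have "c \<in> zeros M {m \<phi> \<psi> | \<phi> \<psi>. \<phi> \<in> \<Phi> \<and> \<psi> \<in> \<Psi>} \<longleftrightarrow> c \<in> zeros M \<Phi> \<union> zeros M \<Psi>" for c
  proof -
    have "c \<in> zeros M {m \<phi> \<psi> | \<phi> \<psi>. \<phi> \<in> \<Phi> \<and> \<psi> \<in> \<Psi>} \<longleftrightarrow>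
        (\<forall>\<phi>\<in>\<Phi>. \<forall>\<psi>\<in>\<Psi>. val M id (\<lambda>_. c) (m \<phi> \<psi>) = 0)"
      unfolding zeros_def by blast
    also have "\<dots> \<longleftrightarrow> (\<forall>\<phi>\<in>\<Phi>. \<forall>\<psi>\<in>\<Psi>. val M id (\<lambda>_. c) \<phi> = 0 \<or> val M id (\<lambda>_. c) \<psi> = 0)"
      by (simp add: zero_m)
    also have "\<dots> \<longleftrightarrow> c \<in> zeros M \<Phi> \<union> zeros M \<Psi>"
      unfolding zeros_def by blast
    finally show ?thesis .
  qed
  then have "- zeros M \<Phi> \<inter> - zeros M \<Psi> = - zeros M {m \<phi> \<psi> | \<phi> \<psi>. \<phi> \<in> \<Phi> \<and> \<psi> \<in> \<Psi>}"
    by blast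
  moreover have "m \<phi> \<psi> \<in> fms1 V UNIV" if "\<phi> \<in> fms1 V UNIV" "\<psi> \<in> fms1 V UNIV" for \<phi> \<psi>
    using that connective_min by (simp add: m_def fms1_def numeral_2_eq_2)
  then have "{m \<phi> \<psi> | \<phi> \<psi>. \<phi> \<in> \<Phi> \<and> \<psi> \<in> \<Psi>} \<subseteq> fms1 V UNIV"
    using \<Phi> \<Psi> by blast
  ultimately show "\<exists>\<Theta>\<subseteq>fms1 V UNIV. - zeros M \<Phi> \<inter> - zeros M \<Psi> = - zeros M \<Theta>"
    by blast
next
  fix \<U>
  assume "\<forall>U\<in>\<U>. \<exists>\<Phi>\<subseteq>fms1 V UNIV. U = - zeros M \<Phi>"
  then obtain F where F: "\<forall>U\<in>\<U>. F U \<subseteq> fms1 V UNIV \<and> U = - zeros M (F U)"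
    by (auto dest!: bchoice)
  have "\<Union>\<U> = (\<Union>U\<in>\<U>. U)"
    by simp
  also have "\<dots> = (\<Union>U\<in>\<U>. - zeros M (F U))"
    by (rule SUP_cong[OF refl]) (use F in blast)
  also have "\<dots> = - zeros M (\<Union>U\<in>\<U>. F U)"
    by (auto simp: zeros_def)
  finally have "\<Union>\<U> = - zeros M (\<Union>U\<in>\<U>. F U)" .
  moreover have "(\<Union>U\<in>\<U>. F U) \<subseteq> fms1 V UNIV"
    using F by blast
  ultimately show "\<exists>\<Phi>\<subseteq>fms1 V UNIV. \<Union>\<U> = - zeros M \<Phi>"
    by blast
qed

lemma closedin_struct_topology:
  assumes M: "is_general_struct V M"
  shows "closedin (struct_topology V M) C \<longleftrightarrow> (\<exists>\<Phi>\<subseteq>fms1 V UNIV. C = zeros M \<Phi>)"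
proof -
  have op: "openin (struct_topology V M) U \<longleftrightarrow> (\<exists>\<Phi>\<subseteq>fms1 V UNIV. U = - zeros M \<Phi>)" for U
    unfolding struct_topology_def by (simp add: topology_inverse'[OF istopology_zeros[OF M]])
  have "zeros M {Conn (\<lambda>_. 1) []} = {}"
    by (simp add: zeros_def)
  moreover have "{Conn (\<lambda>_. 1) []} \<subseteq> fms1 V UNIV"
    using connective_const[of 1 0] by (simp add: fms1_def)
  ultimately have "openin (struct_topology V M) UNIV"
    unfolding op by (metis Compl_empty_eq)
  then have "topspace (struct_topology V M) = UNIV"
    by (meson openin_subset top.extremum_uniqueI)
  then show ?thesis
    unfolding closedin_def op by (metis (no_types) Compl_eq_Diff_UNIV double_complement subset_UNIV)
qed

text \<open>
  Being a monster structure is not part of \<open>lambda_stable\<close>, so that the density condition can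
  also be stated for saturated structures that are not reduced.
\<close>

definition lambda_stable ::
  "'u rel \<Rightarrow> 'l rel \<Rightarrow> ('f, 'c, 'p) vocab \<Rightarrow> ('f, 'c, 'p, 'm, real) struct \<Rightarrow> bool" where
  "lambda_stable \<upsilon> l V M \<longleftrightarrow>
     (\<forall>A :: 'm set. |A| <o \<upsilon> \<and> |A| \<le>o l \<longrightarrow>
        (\<exists>B\<subseteq>types1 V M A. |B| \<le>o l \<and>
           struct_topology V M closure_of {b. tp V M id A b \<in> B}
             = topspace (struct_topology V M)))"

section \<open>Inaccessible cardinals\<close>

definition inaccessible :: "'u rel \<Rightarrow> bool" where
  "inaccessible \<upsilon> \<longleftrightarrow>
     Card_order \<upsilon> \<and> natLeq <o \<upsilon> \<and> regularCard \<upsilon> \<and>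
     (\<forall>X\<subseteq>Field \<upsilon>. |X| <o \<upsilon> \<longrightarrow> |Pow X| <o \<upsilon>)"

section \<open>The structure given by an interpretation\<close>

definition interpreted_struct :: "('f, 'c, 'p) vocab \<Rightarrow> ('f, 'c, 'q, 'm, bool) struct \<Rightarrow>
    ('p \<Rightarrow> real set \<Rightarrow> ('f, 'c, 'q, 'm) fo set) \<Rightarrow> ('f, 'c, 'p, 'm, real) struct \<Rightarrow> bool" where
  "interpreted_struct V K I M \<longleftrightarrow>
     is_general_struct V M \<and>
     (\<forall>c\<in>csyms V. cst M c = cst K c) \<and>
     (\<forall>F\<in>fsyms V. \<forall>b\<in>tuples (farity V F). fn M F b = fn K F b) \<and>
     (\<forall>P\<in>psyms V. \<forall>r\<in>dyadic. \<forall>b\<in>tuples (arity V P).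
        (pr M P b \<in> {0..r} \<longleftrightarrow>
           (\<forall>s\<in>dyadic. r < s \<longrightarrow> b \<in> defset K (arity V P) (I P {0..s}))) \<and>
        (pr M P b \<in> {r..1} \<longleftrightarrow>
           (\<forall>s\<in>dyadic. s < r \<longrightarrow> b \<in> defset K (arity V P) (I P {s..1}))))"

end

theory Submission
  imports Defs
begin

text \<open>
  Fix a small set \<open>A\<close> of parameters. Over \<open>A\<close>, the sets of assignments defined in \<open>K\<close> by sets of
  positive formulas are closed under intersections, finite unions and universal quantification
  for trivial reasons, and under existential quantification because \<open>K\<close> is positively saturated
  (\<open>closedin_positive_topology_Ex\<close>). They are therefore the closed sets of a topology on the
  assignments, the \<open>positive topology\<close>, whose closed sets can be projected along a variable.

  If \<open>A\<close> contains the countably many parameters of the interpretation, then the value of every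
  formula of \<open>V\<close> is a continuous function of the assignment (\<open>continuous_map_val\<close>). For atomic
  formulas this is what an interpretation provides: the conditions \<open>P \<le> r\<close> and \<open>P \<ge> r\<close> are
  intersections of closed sets. Connectives are themselves continuous. An infimum
  is at most \<open>r\<close> iff for every \<open>s > r\<close> some value is at most \<open>s\<close>, which is an intersection of
  projections, and it is at least \<open>r\<close> iff all values are; suprema are dual.

  Consequently the zero set of a one-variable formula of \<open>V\<close> over \<open>A\<close> is defined in \<open>K\<close> by a set
  of positive one-variable formulas over \<open>A\<close> (\<open>zero_set_positively_definable\<close>). A finitely
  satisfiable set of formulas of \<open>V\<close> becomes a finitely satisfiable set of positive formulas, so
  the interpreted structure is saturated. The positive type of an element over \<open>A\<close> determines its
  type over \<open>A\<close> in the interpreted structure, so for \<open>\<lambda>\<close>-stability already the set of all types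
  realized in the structure is small enough, and its realizations are the whole universe.

  Existence and uniqueness of the structure amount to the fact that a number in \<open>[0,1]\<close> is given
  by a Dedekind cut of dyadic rationals: the value of \<open>P\<close> at \<open>b\<close> is the infimum of all \<open>s\<close> for
  which \<open>I P [0,s]\<close> holds at \<open>b\<close>.
\<close>

section \<open>Substitution in terms and first-order formulas\<close>

fun tm_subst :: "(nat \<Rightarrow> ('f, 'c, 'a) tm) \<Rightarrow> ('f, 'c, 'a) tm \<Rightarrow> ('f, 'c, 'a) tm" where
  "tm_subst g (Var x) = g x"
| "tm_subst g (Cst c) = Cst c"
| "tm_subst g (Par a) = Par a"
| "tm_subst g (App F ts) = App F (map (tm_subst g) ts)"

text \<open>
  To avoid capture, every bound variable \<open>x\<close> is renamed to \<open>\<pi> x\<close>, where \<open>\<pi>\<close> is an injection whose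
  range avoids the variables of the substituted terms; free variables \<open>u\<close> with \<open>g u = Var (\<pi> u)\<close>
  are only renamed and cannot be captured, since \<open>\<pi>\<close> is injective.
\<close>

primrec fo_subst :: "(nat \<Rightarrow> nat) \<Rightarrow> (nat \<Rightarrow> ('f, 'c, 'a) tm) \<Rightarrow> ('f, 'c, 'p, 'a) fo \<Rightarrow>
    ('f, 'c, 'p, 'a) fo" where
  "fo_subst \<pi> g (Eq s t) = Eq (tm_subst g s) (tm_subst g t)"
| "fo_subst \<pi> g (Rel P ts) = Rel P (map (tm_subst g) ts)"
| "fo_subst \<pi> g (Neg \<phi>) = Neg (fo_subst \<pi> g \<phi>)"
| "fo_subst \<pi> g (Conj \<phi> \<psi>) = Conj (fo_subst \<pi> g \<phi>) (fo_subst \<pi> g \<psi>)"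
| "fo_subst \<pi> g (Disj \<phi> \<psi>) = Disj (fo_subst \<pi> g \<phi>) (fo_subst \<pi> g \<psi>)"
| "fo_subst \<pi> g (All x \<phi>) = All (\<pi> x) (fo_subst \<pi> (g(x := Var (\<pi> x))) \<phi>)"
| "fo_subst \<pi> g (Ex x \<phi>) = Ex (\<pi> x) (fo_subst \<pi> (g(x := Var (\<pi> x))) \<phi>)"

lemma tm_val_cong: "(\<And>x. x \<in> tm_fv t \<Longrightarrow> \<sigma> x = \<tau> x) \<Longrightarrow> tm_val S e \<sigma> t = tm_val S e \<tau> t"
proof (induction t)
  case (App F ts)
  then have "map (tm_val S e \<sigma>) ts = map (tm_val S e \<tau>) ts"
    by (intro map_cong) auto
  then show ?case by (simp only: tm_val.simps)
qed auto

lemma sat_cong: "(\<And>x. x \<in> fo_fv \<phi> \<Longrightarrow> \<sigma> x = \<tau> x) \<Longrightarrow> sat K e \<sigma> \<phi> \<longleftrightarrow> sat K e \<tau> \<phi>"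
proof (induction \<phi> arbitrary: \<sigma> \<tau>)
  case (Eq s t)
  then show ?case
    using tm_val_cong[of s \<sigma> \<tau> K e] tm_val_cong[of t \<sigma> \<tau> K e] by simp
next
  case (Rel P ts)
  then have "map (tm_val K e \<sigma>) ts = map (tm_val K e \<tau>) ts"
    by (intro map_cong refl tm_val_cong) auto
  then show ?case by (simp only: sat.simps)
next
  case (Neg \<phi>)
  then show ?case by (metis fo_fv.simps(3) sat.simps(3))
next
  case (Conj \<phi> \<psi>)
  then show ?case by (metis UnCI fo_fv.simps(4) sat.simps(4))
next
  case (Disj \<phi> \<psi>)
  then show ?case by (metis UnCI fo_fv.simps(5) sat.simps(5))
next
  case (All x \<phi>)
  have "sat K e (\<sigma>(x := a)) \<phi> \<longleftrightarrow> sat K e (\<tau>(x := a)) \<phi>" for a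
    by (rule All.IH) (use All.prems in auto)
  then show ?case by simp
next
  case (Ex x \<phi>)
  have "sat K e (\<sigma>(x := a)) \<phi> \<longleftrightarrow> sat K e (\<tau>(x := a)) \<phi>" for a
    by (rule Ex.IH) (use Ex.prems in auto)
  then show ?case by simp
qed

lemma tm_val_subst: "tm_val S e \<tau> (tm_subst g t) = tm_val S e (\<lambda>u. tm_val S e \<tau> (g u)) t"
proof (induction t)
  case (App F ts)
  then have "map (tm_val S e \<tau> \<circ> tm_subst g) ts = map (tm_val S e (\<lambda>u. tm_val S e \<tau> (g u))) ts"
    by (intro map_cong) auto
  then show ?case by (simp only: tm_subst.simps tm_val.simps map_map)
qed auto

lemma tm_wf_subst: "tm_wf W t \<Longrightarrow> (\<And>u. tm_wf W (g u)) \<Longrightarrow> tm_wf W (tm_subst g t)"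
  by (induction t) auto

lemma tm_fv_subst: "tm_fv (tm_subst g t) = (\<Union>u\<in>tm_fv t. tm_fv (g u))"
  by (induction t) auto

lemma tm_params_subst:
  "tm_params (tm_subst g t) = tm_params t \<union> (\<Union>u\<in>tm_fv t. tm_params (g u))"
  by (induction t) auto

lemma finite_tm_fv: "finite (tm_fv t)"
  by (induction t) auto

lemma subst_update:
  assumes "inj \<pi>" and "\<And>u. g u = Var (\<pi> u) \<or> tm_fv (g u) \<inter> range \<pi> = {}"
  shows "(\<lambda>u. tm_val S e (\<tau>(\<pi> x := a)) ((g(x := Var (\<pi> x))) u)) = (\<lambda>u. tm_val S e \<tau> (g u))(x := a)"
proof
  fix u
  have "tm_val S e (\<tau>(\<pi> x := a)) (g u) = tm_val S e \<tau> (g u)" if "u \<noteq> x"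
    by (rule tm_val_cong) (use that assms(2)[of u] injD[OF assms(1), of u x] in auto)
  then show "tm_val S e (\<tau>(\<pi> x := a)) ((g(x := Var (\<pi> x))) u)
      = ((\<lambda>u. tm_val S e \<tau> (g u))(x := a)) u"
    by simp
qed

lemma sat_subst:
  assumes "inj \<pi>" and "\<And>u. g u = Var (\<pi> u) \<or> tm_fv (g u) \<inter> range \<pi> = {}"
  shows "sat K e \<tau> (fo_subst \<pi> g \<phi>) \<longleftrightarrow> sat K e (\<lambda>u. tm_val K e \<tau> (g u)) \<phi>"
  using assms(2)
proof (induction \<phi> arbitrary: \<tau> g)
  case (Eq s t)
  then show ?case by (simp add: tm_val_subst)
next
  case (Rel P ts)
  have "map (tm_val K e \<tau> \<circ> tm_subst g) ts = map (tm_val K e (\<lambda>u. tm_val K e \<tau> (g u))) ts"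
    by (simp add: tm_val_subst)
  then show ?case by (simp only: fo_subst.simps sat.simps map_map)
next
  case (Neg \<phi>)
  then show ?case by simp
next
  case (Conj \<phi> \<psi>)
  then show ?case by simp
next
  case (Disj \<phi> \<psi>)
  then show ?case by simp
next
  case (All x \<phi>)
  have "(\<lambda>u. tm_val K e (\<tau>(\<pi> x := a)) ((g(x := Var (\<pi> x))) u))
      = (\<lambda>u. tm_val K e \<tau> (g u))(x := a)" for a
    by (rule subst_update[OF assms(1) All.prems])
  moreover have "(g(x := Var (\<pi> x))) u = Var (\<pi> u) \<or> tm_fv ((g(x := Var (\<pi> x))) u) \<inter> range \<pi> = {}"
    for u using All.prems[of u] by simp
  ultimately show ?case by (simp add: All.IH del: fun_upd_apply)
next
  case (Ex x \<phi>)
  have "(\<lambda>u. tm_val K e (\<tau>(\<pi> x := a)) ((g(x := Var (\<pi> x))) u))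
      = (\<lambda>u. tm_val K e \<tau> (g u))(x := a)" for a
    by (rule subst_update[OF assms(1) Ex.prems])
  moreover have "(g(x := Var (\<pi> x))) u = Var (\<pi> u) \<or> tm_fv ((g(x := Var (\<pi> x))) u) \<inter> range \<pi> = {}"
    for u using Ex.prems[of u] by simp
  ultimately show ?case by (simp add: Ex.IH del: fun_upd_apply)
qed

lemma fo_wf_subst: "fo_wf W \<phi> \<Longrightarrow> (\<And>u. tm_wf W (g u)) \<Longrightarrow> fo_wf W (fo_subst \<pi> g \<phi>)"
  by (induction \<phi> arbitrary: g) (auto simp: tm_wf_subst)

lemma positive_subst: "positive (fo_subst \<pi> g \<phi>) \<longleftrightarrow> positive \<phi>"
  by (induction \<phi> arbitrary: g) auto

lemma fo_fv_subst: "fo_fv (fo_subst \<pi> g \<phi>) \<subseteq> (\<Union>u\<in>fo_fv \<phi>. tm_fv (g u))"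
proof (induction \<phi> arbitrary: g)
  case (All x \<phi>)
  have "(\<Union>u\<in>fo_fv \<phi>. tm_fv ((g(x := Var (\<pi> x))) u)) \<subseteq> {\<pi> x} \<union> (\<Union>u\<in>fo_fv \<phi> - {x}. tm_fv (g u))"
    by (auto split: if_splits)
  then show ?case using All.IH[of "g(x := Var (\<pi> x))"] by (simp only: fo_subst.simps fo_fv.simps) blast
next
  case (Ex x \<phi>)
  have "(\<Union>u\<in>fo_fv \<phi>. tm_fv ((g(x := Var (\<pi> x))) u)) \<subseteq> {\<pi> x} \<union> (\<Union>u\<in>fo_fv \<phi> - {x}. tm_fv (g u))"
    by (auto split: if_splits)
  then show ?case using Ex.IH[of "g(x := Var (\<pi> x))"] by (simp only: fo_subst.simps fo_fv.simps) blast
qed (fastforce simp: tm_fv_subst)+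

lemma fo_params_subst:
  "fo_params (fo_subst \<pi> g \<phi>) \<subseteq> fo_params \<phi> \<union> (\<Union>u\<in>fo_fv \<phi>. tm_params (g u))"
proof (induction \<phi> arbitrary: g)
  case (All x \<phi>)
  have "(\<Union>u\<in>fo_fv \<phi>. tm_params ((g(x := Var (\<pi> x))) u)) \<subseteq> (\<Union>u\<in>fo_fv \<phi> - {x}. tm_params (g u))"
    by (auto split: if_splits)
  then show ?case using All.IH[of "g(x := Var (\<pi> x))"]
    by (simp only: fo_subst.simps fo_fv.simps fo_params.simps) blast
next
  case (Ex x \<phi>)
  have "(\<Union>u\<in>fo_fv \<phi>. tm_params ((g(x := Var (\<pi> x))) u)) \<subseteq> (\<Union>u\<in>fo_fv \<phi> - {x}. tm_params (g u))"
    by (auto split: if_splits)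
  then show ?case using Ex.IH[of "g(x := Var (\<pi> x))"]
    by (simp only: fo_subst.simps fo_fv.simps fo_params.simps) blast
qed (fastforce simp: tm_params_subst)+

section \<open>The topology of positively definable sets of assignments\<close>

definition pos_fms :: "('f, 'c, 'p) vocab \<Rightarrow> 'a set \<Rightarrow> ('f, 'c, 'p, 'a) fo set" where
  "pos_fms W A = {\<phi>. fo_wf W \<phi> \<and> positive \<phi> \<and> fo_params \<phi> \<subseteq> A}"

definition models :: "('f, 'c, 'p, 'm, bool) struct \<Rightarrow> ('f, 'c, 'p, 'm) fo set \<Rightarrow> (nat \<Rightarrow> 'm) set" where
  "models K \<Theta> = {\<sigma>. \<forall>\<theta>\<in>\<Theta>. sat K id \<sigma> \<theta>}"

definition positive_topology ::
  "('f, 'c, 'p) vocab \<Rightarrow> ('f, 'c, 'p, 'm, bool) struct \<Rightarrow> 'm set \<Rightarrow> (nat \<Rightarrow> 'm) topology" where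
  "positive_topology W K A = topology (\<lambda>U. \<exists>\<Theta>\<subseteq>pos_fms W A. U = - models K \<Theta>)"

lemma istopology_models:
  fixes K :: "('f, 'c, 'q, 'm, bool) struct"
  shows "istopology (\<lambda>U. \<exists>\<Theta>\<subseteq>pos_fms W A. U = - models K \<Theta>)"
  unfolding istopology_def
proof safe
  fix \<Theta> \<Xi> :: "('f, 'c, 'q, 'm) fo set"
  assume \<Theta>: "\<Theta> \<subseteq> pos_fms W A" and \<Xi>: "\<Xi> \<subseteq> pos_fms W A"
  let ?D = "{Disj \<theta> \<xi> | \<theta> \<xi>. \<theta> \<in> \<Theta> \<and> \<xi> \<in> \<Xi>}"
  have "?D \<subseteq> pos_fms W A"
    using \<Theta> \<Xi> by (fastforce simp: pos_fms_def)
  moreover have "models K ?D = {\<sigma>. \<forall>\<theta>\<in>\<Theta>. \<forall>\<xi>\<in>\<Xi>. sat K id \<sigma> (Disj \<theta> \<xi>)}"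
    unfolding models_def by blast
  then have "models K ?D = models K \<Theta> \<union> models K \<Xi>"
    unfolding models_def sat.simps by blast
  then have "- models K \<Theta> \<inter> - models K \<Xi> = - models K ?D" by blast
  ultimately show "\<exists>\<Upsilon>\<subseteq>pos_fms W A. - models K \<Theta> \<inter> - models K \<Xi> = - models K \<Upsilon>" by blast
next
  fix \<U> :: "(nat \<Rightarrow> 'm) set set"
  assume "\<forall>U\<in>\<U>. \<exists>\<Theta>\<subseteq>pos_fms W A. U = - models K \<Theta>"
  then obtain F where F: "\<forall>U\<in>\<U>. F U \<subseteq> pos_fms W A \<and> U = - models K (F U)"
    by (auto dest!: bchoice)
  have "\<Union>\<U> = (\<Union>U\<in>\<U>. U)" by simp
  also have "\<dots> = (\<Union>U\<in>\<U>. - models K (F U))"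
    by (rule SUP_cong[OF refl]) (use F in blast)
  also have "\<dots> = - models K (\<Union>U\<in>\<U>. F U)"
    by (auto simp: models_def)
  finally have "\<Union>\<U> = - models K (\<Union>U\<in>\<U>. F U)" .
  moreover have "(\<Union>U\<in>\<U>. F U) \<subseteq> pos_fms W A" using F by blast
  ultimately show "\<exists>\<Theta>\<subseteq>pos_fms W A. \<Union>\<U> = - models K \<Theta>" by blast
qed

lemma openin_positive_topology:
  "openin (positive_topology W K A) U \<longleftrightarrow> (\<exists>\<Theta>\<subseteq>pos_fms W A. U = - models K \<Theta>)"
  unfolding positive_topology_def by (simp add: topology_inverse'[OF istopology_models])

lemma infinite_Field: "natLeq <o \<upsilon> \<Longrightarrow> infinite (Field \<upsilon>)"
  using cinfinite_mono[OF ordLess_imp_ordLeq natLeq_cinfinite] by (simp add: cinfinite_def)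

text \<open>
  The parameters range over a small set \<open>A\<close>. In an infinite universe \<open>\<forall>x y. x = y\<close> is a
  false positive formula, which makes the empty set closed.
\<close>

locale positive_context =
  fixes \<upsilon> :: "'u rel" and W :: "('f, 'c, 'q) vocab" and K :: "('f, 'c, 'q, 'm, bool) struct"
    and A :: "'m set"
  assumes saturated_K: "positively_saturated \<upsilon> W K"
    and card_order: "Card_order \<upsilon>" and uncountable: "natLeq <o \<upsilon>"
    and small: "|A| <o \<upsilon>" and infinite_UNIV: "infinite (UNIV :: 'm set)"
begin

abbreviation "T \<equiv> positive_topology W K A"

lemma topspace_T: "topspace T = UNIV"
proof -
  let ?f = "All 0 (All 1 (Eq (Var 0) (Var 1))) :: ('f, 'c, 'q, 'm) fo"
  obtain a b :: 'm where "a \<noteq> b"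
    using infinite_UNIV by (metis (full_types) UNIV_eq_I finite.simps insert_iff)
  then have "\<not> sat K id \<sigma> ?f" for \<sigma> by auto
  then have "models K {?f} = {}" by (simp only: models_def) blast
  then have "openin T UNIV"
    unfolding openin_positive_topology
    by (intro exI[of _ "{?f}"]) (auto simp: pos_fms_def)
  then show ?thesis by (meson openin_subset top.extremum_uniqueI)
qed

lemma closedin_T: "closedin T X \<longleftrightarrow> (\<exists>\<Theta>\<subseteq>pos_fms W A. X = models K \<Theta>)"
  unfolding closedin_def topspace_T openin_positive_topology
  by (metis (no_types) Compl_eq_Diff_UNIV double_complement subset_UNIV)

lemma closedin_sat: "\<theta> \<in> pos_fms W A \<Longrightarrow> closedin T {\<sigma>. sat K id \<sigma> \<theta>}"
  unfolding closedin_T by (rule exI[of _ "{\<theta>}"]) (auto simp: models_def)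

lemma closedin_T_all:
  assumes "\<And>i. closedin T {\<sigma>. Q i \<sigma>}"
  shows "closedin T {\<sigma>. \<forall>i. Q i \<sigma>}"
proof -
  have "closedin T (\<Inter>i. {\<sigma>. Q i \<sigma>})"
    by (rule closedin_Inter) (use assms in auto)
  then show ?thesis by (simp add: INTER_eq)
qed

lemma closedin_T_imp: "(Q \<Longrightarrow> closedin T {\<sigma>. R \<sigma>}) \<Longrightarrow> closedin T {\<sigma>. Q \<longrightarrow> R \<sigma>}"
  using closedin_topspace[of T] by (cases Q) (auto simp: topspace_T)

lemma closedin_positive_topology_All:
  assumes "closedin T X"
  shows "closedin T {\<sigma>. \<forall>a. \<sigma>(x := a) \<in> X}"
proof -
  obtain \<Theta> where "\<Theta> \<subseteq> pos_fms W A" "X = models K \<Theta>"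
    using assms closedin_T by blast
  then show ?thesis
    unfolding closedin_T by (intro exI[of _ "All x ` \<Theta>"]) (fastforce simp: models_def pos_fms_def)
qed

text \<open>
  Saturation speaks about formulas in the variable \<open>0\<close>; the values of \<open>\<sigma>\<close> at the other variables
  become countably many new parameters, so that fewer than \<open>\<upsilon>\<close> parameters occur.
\<close>

lemma saturated_at_variable:
  assumes \<Theta>: "\<Theta> \<subseteq> pos_fms W A"
    and fin: "\<And>\<Psi>. finite \<Psi> \<Longrightarrow> \<Psi> \<subseteq> \<Theta> \<Longrightarrow> \<exists>a. \<sigma>(x := a) \<in> models K \<Psi>"
  shows "\<exists>a. \<sigma>(x := a) \<in> models K \<Theta>"
proof -
  \<comment> \<open>\<open>x\<close> becomes \<open>0\<close>; all other bound variables are shifted out of its way\<close>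
  define \<pi> where "\<pi> = (\<lambda>u. if u = x then 0 else Suc u)"
  define g where "g = (\<lambda>u. if u = x then Var 0 else Par (\<sigma> u) :: ('f, 'c, 'm) tm)"
  have val_g: "(\<lambda>u. tm_val K id (\<lambda>_. a) (g u)) = \<sigma>(x := a)" for a
    by (auto simp: g_def)
  have sat_g: "sat K id (\<lambda>_. a) (fo_subst \<pi> g \<theta>) \<longleftrightarrow> sat K id (\<sigma>(x := a)) \<theta>" for a \<theta>
    unfolding val_g[symmetric] by (rule sat_subst) (auto simp: inj_def \<pi>_def g_def)
  have fv: "fo_fv (fo_subst \<pi> g \<theta>) \<subseteq> {0}" for \<theta> :: "('f, 'c, 'q, 'm) fo"
    using fo_fv_subst[of \<pi> g \<theta>] by (auto simp: g_def split: if_splits)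
  have "fo_params (fo_subst \<pi> g \<theta>) \<subseteq> A \<union> range \<sigma>" if "\<theta> \<in> \<Theta>" for \<theta>
    using fo_params_subst[of \<pi> g \<theta>] that \<Theta> by (fastforce simp: g_def pos_fms_def split: if_splits)
  then have "(\<Union>\<phi>\<in>fo_subst \<pi> g ` \<Theta>. fo_params \<phi>) \<subseteq> A \<union> range \<sigma>"
    by blast
  moreover have "|A \<union> range \<sigma>| <o \<upsilon>"
  proof (rule card_of_Un_ordLess_infinite_Field)
    show "infinite (Field \<upsilon>)"
      using uncountable by (rule infinite_Field)
    have "|range \<sigma>| \<le>o |UNIV :: nat set|" by (rule card_of_image)
    also have "|UNIV :: nat set| =o natLeq" by (rule card_of_nat)
    finally show "|range \<sigma>| <o \<upsilon>" using uncountable by (rule ordLeq_ordLess_trans)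
  qed (fact card_order small)+
  ultimately have "|\<Union>\<phi>\<in>fo_subst \<pi> g ` \<Theta>. fo_params \<phi>| <o \<upsilon>"
    by (meson card_of_mono1 ordLeq_ordLess_trans)
  moreover have "\<forall>\<phi>\<in>fo_subst \<pi> g ` \<Theta>. fo_wf W \<phi> \<and> positive \<phi> \<and> fo_fv \<phi> \<subseteq> {0}"
    using \<Theta> fv by (auto simp: pos_fms_def positive_subst g_def intro!: fo_wf_subst)
  moreover have "\<exists>b. \<forall>\<phi>\<in>\<Psi>. sat K id (\<lambda>_. b) \<phi>"
    if "\<Psi> \<subseteq> fo_subst \<pi> g ` \<Theta>" "finite \<Psi>" for \<Psi>
  proof -
    obtain \<Psi>' where "\<Psi>' \<subseteq> \<Theta>" "finite \<Psi>'" "\<Psi> = fo_subst \<pi> g ` \<Psi>'"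
      using finite_subset_image[OF \<open>finite \<Psi>\<close> \<open>\<Psi> \<subseteq> fo_subst \<pi> g ` \<Theta>\<close>] by blast
    then show ?thesis using fin[of \<Psi>'] by (auto simp: models_def sat_g)
  qed
  ultimately have "\<exists>b. \<forall>\<phi>\<in>fo_subst \<pi> g ` \<Theta>. sat K id (\<lambda>_. b) \<phi>"
    using saturated_K[unfolded positively_saturated_def, rule_format, of "fo_subst \<pi> g ` \<Theta>"]
    by blast
  then show ?thesis by (auto simp: models_def sat_g)
qed

text \<open>
  By saturation an existential quantifier commutes with the conjunction of a set of positive
  formulas that is closed under finite conjunctions.
\<close>

lemma closedin_positive_topology_Ex:
  assumes "closedin T X"
  shows "closedin T {\<sigma>. \<exists>a. \<sigma>(x := a) \<in> X}"
proof -
  obtain \<Theta> where \<Theta>: "\<Theta> \<subseteq> pos_fms W A" "X = models K \<Theta>"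
    using assms closedin_T by blast
  define conj :: "('f, 'c, 'q, 'm) fo list \<Rightarrow> ('f, 'c, 'q, 'm) fo"
    where "conj = (\<lambda>\<psi>s. foldr Conj \<psi>s (Eq (Var 0) (Var 0)))"
  have sat_conj: "sat K id \<sigma> (conj \<psi>s) \<longleftrightarrow> \<sigma> \<in> models K (set \<psi>s)" for \<sigma> \<psi>s
    unfolding conj_def by (induction \<psi>s) (auto simp: models_def id_def)
  have conj_pos: "conj \<psi>s \<in> pos_fms W A" if "set \<psi>s \<subseteq> \<Theta>" for \<psi>s
    using that \<Theta>(1) unfolding conj_def by (induction \<psi>s) (auto simp: pos_fms_def)
  let ?E = "{Ex x (conj \<psi>s) | \<psi>s. set \<psi>s \<subseteq> \<Theta>}"
  have "(\<exists>a. \<sigma>(x := a) \<in> X) \<longleftrightarrow> \<sigma> \<in> models K ?E" for \<sigma>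
  proof
    assume "\<exists>a. \<sigma>(x := a) \<in> X"
    then show "\<sigma> \<in> models K ?E"
      unfolding \<Theta>(2) by (auto simp: models_def sat_conj; blast)
  next
    assume "\<sigma> \<in> models K ?E"
    then have *: "\<exists>a. \<sigma>(x := a) \<in> models K (set \<psi>s)" if "set \<psi>s \<subseteq> \<Theta>" for \<psi>s
    proof -
      have "Ex x (conj \<psi>s) \<in> ?E" using that by blast
      with \<open>\<sigma> \<in> models K ?E\<close> have "sat K id \<sigma> (Ex x (conj \<psi>s))"
        unfolding models_def by blast
      then show ?thesis by (simp add: sat_conj)
    qed
    show "\<exists>a. \<sigma>(x := a) \<in> X"
      unfolding \<Theta>(2) by (rule saturated_at_variable[OF \<Theta>(1)]) (metis * finite_list)
  qed
  moreover have "?E \<subseteq> pos_fms W A"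
    using conj_pos by (fastforce simp: pos_fms_def)
  ultimately show ?thesis
    unfolding closedin_T by (intro exI[of _ ?E]) auto
qed

text \<open>
  Positive conditions on the values of terms are closed conditions on assignments: the terms can
  be substituted for the free variables once the bound variables are shifted beyond all
  variables of the terms.
\<close>

lemma closedin_sat_subst:
  assumes "\<theta> \<in> pos_fms W A" and "fo_fv \<theta> \<subseteq> {..<length ts}"
    and ts: "\<And>t. t \<in> set ts \<Longrightarrow> tm_wf W t \<and> tm_params t \<subseteq> A"
  shows "closedin T {\<sigma>. sat K id (\<lambda>i. map (tm_val K id \<sigma>) ts ! i) \<theta>}"
proof -
  have "finite (\<Union>t\<in>set ts. tm_fv t)" by (simp add: finite_tm_fv)
  then obtain N where N: "\<And>t u. t \<in> set ts \<Longrightarrow> u \<in> tm_fv t \<Longrightarrow> u < N"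
    by (metis (no_types, lifting) UN_iff finite_nat_set_iff_bounded)
  define \<pi> where "\<pi> = (\<lambda>u. u + N)"
  define g where "g = (\<lambda>u. if u < length ts then ts ! u else Var (\<pi> u))"
  have g: "g u = Var (\<pi> u) \<or> tm_fv (g u) \<inter> range \<pi> = {}" for u
  proof (cases "u < length ts")
    case True
    then have "v < N" if "v \<in> tm_fv (g u)" for v
      using N[of "ts ! u" v] that by (simp add: g_def)
    then show ?thesis by (fastforce simp: \<pi>_def)
  qed (simp add: g_def)
  have "sat K id (\<lambda>i. map (tm_val K id \<sigma>) ts ! i) \<theta> \<longleftrightarrow> sat K id \<sigma> (fo_subst \<pi> g \<theta>)" for \<sigma>
  proof -
    have "sat K id (\<lambda>i. map (tm_val K id \<sigma>) ts ! i) \<theta>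
        \<longleftrightarrow> sat K id (\<lambda>u. tm_val K id \<sigma> (g u)) \<theta>"
      by (rule sat_cong) (use assms(2) in \<open>auto simp: g_def\<close>)
    also have "\<dots> \<longleftrightarrow> sat K id \<sigma> (fo_subst \<pi> g \<theta>)"
    proof (rule sat_subst[symmetric])
      show "inj \<pi>" by (simp add: inj_def \<pi>_def)
    qed (rule g)
    finally show ?thesis .
  qed
  moreover have "tm_wf W (g u) \<and> tm_params (g u) \<subseteq> A" for u
    using ts by (simp add: g_def)
  then have "fo_subst \<pi> g \<theta> \<in> pos_fms W A"
    using assms(1) fo_params_subst[of \<pi> g \<theta>]
    by (fastforce simp: pos_fms_def positive_subst intro!: fo_wf_subst)
  ultimately show ?thesis using closedin_sat by simp
qed

text \<open>
  Substituting the variable \<open>0\<close> for all free variables turns a positive formula into one in a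
  single variable, and does not change its truth value at constant assignments.
\<close>

lemma closedin_diagonal:
  assumes "closedin T X"
  obtains \<Theta> where "\<Theta> \<subseteq> pos_fms W A" and "\<And>\<theta>. \<theta> \<in> \<Theta> \<Longrightarrow> fo_fv \<theta> \<subseteq> {0}"
    and "\<And>b. (\<lambda>_. b) \<in> X \<longleftrightarrow> (\<forall>\<theta>\<in>\<Theta>. sat K id (\<lambda>_. b) \<theta>)"
proof -
  obtain \<Theta> where \<Theta>: "\<Theta> \<subseteq> pos_fms W A" "X = models K \<Theta>"
    using assms closedin_T by blast
  let ?d = "fo_subst Suc (\<lambda>_. Var 0) :: ('f, 'c, 'q, 'm) fo \<Rightarrow> _"
  have sat_d: "sat K id \<tau> (?d \<theta>) \<longleftrightarrow> sat K id (\<lambda>_. \<tau> 0) \<theta>" for \<tau> \<theta>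
    by (subst sat_subst) auto
  show ?thesis
  proof (rule that[of "?d ` \<Theta>"])
    show "?d ` \<Theta> \<subseteq> pos_fms W A"
      using \<Theta>(1) fo_params_subst[of Suc "\<lambda>_. Var 0"]
      by (fastforce simp: pos_fms_def positive_subst intro!: fo_wf_subst)
    show "fo_fv \<theta> \<subseteq> {0}" if "\<theta> \<in> ?d ` \<Theta>" for \<theta>
      using that fo_fv_subst[of Suc "\<lambda>_. Var 0"] by fastforce
    show "(\<lambda>_. b) \<in> X \<longleftrightarrow> (\<forall>\<theta>\<in>?d ` \<Theta>. sat K id (\<lambda>_. b) \<theta>)" for b
      by (auto simp: \<Theta>(2) models_def sat_d)
  qed
qed

text \<open>
  An infimum need not be attained, so \<open>INF \<le> r\<close> is the conjunction over all \<open>s > r\<close> of the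
  existence of values \<open>\<le> s\<close>. The lower bound \<open>c\<close> keeps the infimum meaningful.
\<close>

lemma continuous_map_INF:
  assumes f: "continuous_map T euclideanreal f" and "\<And>\<sigma>. c \<le> f \<sigma>"
  shows "continuous_map T euclideanreal (\<lambda>\<sigma>. INF a. f (\<sigma>(x := a)))"
proof -
  have bdd: "bdd_below (range (\<lambda>a. f (\<sigma>(x := a))))" for \<sigma>
    by (rule bdd_belowI[of _ c]) (use assms(2) in auto)
  have "closedin T {\<sigma>. (INF a. f (\<sigma>(x := a))) \<ge> r}" for r
  proof -
    have "closedin T {\<sigma>. f \<sigma> \<ge> r}"
      using f by (auto simp: continuous_map_upper_lower_semicontinuous_le topspace_T)
    then have "closedin T {\<sigma>. \<forall>a. f (\<sigma>(x := a)) \<ge> r}"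
      by (drule_tac closedin_positive_topology_All) simp
    moreover have "(INF a. f (\<sigma>(x := a))) \<ge> r \<longleftrightarrow> (\<forall>a. f (\<sigma>(x := a)) \<ge> r)" for \<sigma>
      using bdd by (simp add: le_cINF_iff)
    ultimately show ?thesis by simp
  qed
  moreover have "closedin T {\<sigma>. (INF a. f (\<sigma>(x := a))) \<le> r}" for r
  proof -
    have "(INF a. f (\<sigma>(x := a))) \<le> r \<longleftrightarrow> (\<forall>s. r < s \<longrightarrow> (\<exists>a. f (\<sigma>(x := a)) \<le> s))" for \<sigma>
    proof
      assume L: "(INF a. f (\<sigma>(x := a))) \<le> r"
      show "\<forall>s. r < s \<longrightarrow> (\<exists>a. f (\<sigma>(x := a)) \<le> s)"
      proof (intro allI impI)
        fix s assume "r < s"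
        with L have "(INF a. f (\<sigma>(x := a))) < s" by simp
        then show "\<exists>a. f (\<sigma>(x := a)) \<le> s"
          using bdd by (subst (asm) cINF_less_iff) (auto intro: less_imp_le)
      qed
    next
      assume R: "\<forall>s. r < s \<longrightarrow> (\<exists>a. f (\<sigma>(x := a)) \<le> s)"
      show "(INF a. f (\<sigma>(x := a))) \<le> r"
        by (rule dense_ge) (use R bdd in \<open>meson UNIV_I cINF_lower2\<close>)
    qed
    moreover have "closedin T {\<sigma>. f \<sigma> \<le> s}" for s
      using f by (auto simp: continuous_map_upper_lower_semicontinuous_le topspace_T)
    then have "closedin T {\<sigma>. \<exists>a. f (\<sigma>(x := a)) \<le> s}" for s
      using closedin_positive_topology_Ex by fastforce
    ultimately show ?thesis
      by (simp add: closedin_T_all closedin_T_imp)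
  qed
  ultimately show ?thesis
    by (simp add: continuous_map_upper_lower_semicontinuous_le topspace_T)
qed

lemma continuous_map_SUP:
  assumes f: "continuous_map T euclideanreal f" and "\<And>\<sigma>. f \<sigma> \<le> c"
  shows "continuous_map T euclideanreal (\<lambda>\<sigma>. SUP a. f (\<sigma>(x := a)))"
proof -
  have "continuous_map T euclideanreal (\<lambda>\<sigma>. INF a. - f (\<sigma>(x := a)))"
    by (rule continuous_map_INF[where c = "- c"]) (use assms in \<open>auto intro: continuous_intros\<close>)
  then have "continuous_map T euclideanreal (\<lambda>\<sigma>. - (INF a. - f (\<sigma>(x := a))))"
    by (auto intro: continuous_intros)
  moreover have "- (INF a. - f (\<sigma>(x := a))) = (SUP a. f (\<sigma>(x := a)))" for \<sigma>
    by (simp add: Inf_real_def image_comp)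
  ultimately show ?thesis by simp
qed

end

section \<open>Dyadic rationals and the interpreted structure\<close>

lemma dyadic_between:
  assumes "0 \<le> a" "a < b" "b \<le> 1"
  obtains q where "q \<in> dyadic" "a < q" "q < b"
proof -
  have pos: "0 < (b - a) / 2" "1 < (2::real)" "0 < (a + b) / 2"
    using assms by auto
  obtain n q r where "of_nat q / 2 ^ n < (a + b) / 2" "(a + b) / 2 < of_nat r / 2 ^ n"
    "\<bar>q / 2 ^ n - r / 2 ^ n\<bar> < (b - a) / 2"
    using padic_rational_approximation_straddle_pos[of "(b - a) / 2" 2 "(a + b) / 2", OF pos] by blast
  then have "a < real r / 2 ^ n" "real r / 2 ^ n < b"
    by (auto simp: field_simps abs_if split: if_splits)
  moreover from this have "real r / 2 ^ n \<le> 1" using assms by linarith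
  then have "real r / 2 ^ n \<in> dyadic" by (auto simp: dyadic_def)
  ultimately show ?thesis using that by blast
qed

lemma dyadic_range: "r \<in> dyadic \<Longrightarrow> 0 \<le> r \<and> r \<le> 1"
  by (simp add: dyadic_def)

lemma countable_dyadic: "countable dyadic"
proof -
  have "dyadic \<subseteq> (\<lambda>(k::nat, n::nat). real k / 2 ^ n) ` UNIV"
    by (auto simp: dyadic_def image_def)
  then show ?thesis by (rule countable_subset) auto
qed

lemma dyadic_intervals_memI:
  "s \<in> dyadic \<Longrightarrow> {0..s} \<in> dyadic_intervals"
  "s \<in> dyadic \<Longrightarrow> {s..1} \<in> dyadic_intervals"
  unfolding dyadic_intervals_def by blast+

lemma dyadic_le_iff:
  assumes "a \<in> {0..1}" "0 \<le> b"
  shows "a \<le> b \<longleftrightarrow> (\<forall>q\<in>dyadic. b \<le> q \<longrightarrow> a \<le> q)"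
proof -
  have False if "b < a" "\<forall>q\<in>dyadic. b \<le> q \<longrightarrow> a \<le> q"
    using dyadic_between[of b a] that assms by fastforce
  then show ?thesis by fastforce
qed

lemma dyadic_ge_iff:
  assumes "a \<in> {0..1}" "b \<le> 1"
  shows "b \<le> a \<longleftrightarrow> (\<forall>q\<in>dyadic. q \<le> b \<longrightarrow> q \<le> a)"
proof -
  have False if "a < b" "\<forall>q\<in>dyadic. q \<le> b \<longrightarrow> q \<le> a"
    using dyadic_between[of a b] that assms by fastforce
  then show ?thesis by fastforce
qed

text \<open>
  For a point \<open>b\<close>, the sets \<open>L\<close> and \<open>U\<close> consist of the \<open>s\<close> for which \<open>I P [0,s]\<close>, respectively
  \<open>I P [s,1]\<close>, holds at \<open>b\<close>. Disjointness and covering say that they are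
  complementary up to one dyadic point, where the cut lies. Adding \<open>1\<close> to \<open>L\<close> covers the case of empty \<open>L\<close>.
\<close>

lemma dyadic_cut:
  assumes mono: "\<And>r s. r \<in> dyadic \<Longrightarrow> s \<in> dyadic \<Longrightarrow> r < s \<Longrightarrow> r \<in> L \<Longrightarrow> s \<in> L"
    and disj: "\<And>r s. r \<in> dyadic \<Longrightarrow> s \<in> dyadic \<Longrightarrow> r < s \<Longrightarrow> r \<in> L \<Longrightarrow> s \<notin> U"
    and cover: "\<And>r s. r \<in> dyadic \<Longrightarrow> s \<in> dyadic \<Longrightarrow> r < s \<Longrightarrow> r \<in> U \<or> s \<in> L"
  defines "p \<equiv> Inf (L \<inter> dyadic \<union> {1})"
  shows "p \<in> {0..1}"
    and "r \<in> dyadic \<Longrightarrow> p \<in> {0..r} \<longleftrightarrow> (\<forall>s\<in>dyadic. r < s \<longrightarrow> s \<in> L)"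
    and "r \<in> dyadic \<Longrightarrow> p \<in> {r..1} \<longleftrightarrow> (\<forall>s\<in>dyadic. s < r \<longrightarrow> s \<in> U)"
proof -
  have bdd: "bdd_below (L \<inter> dyadic \<union> {1})"
    by (rule bdd_belowI[of _ 0]) (auto dest: dyadic_range)
  have p_less: "p < x \<longleftrightarrow> (\<exists>s\<in>L \<inter> dyadic \<union> {1}. s < x)" for x
    unfolding p_def using bdd by (subst cInf_less_iff) auto
  have p0: "0 \<le> p"
    unfolding p_def by (rule cInf_greatest) (auto dest: dyadic_range)
  have p1: "p \<le> 1"
    unfolding p_def using bdd by (auto intro: cInf_lower)
  show p: "p \<in> {0..1}" using p0 p1 by simp
  {
    assume r: "r \<in> dyadic"
    have "s \<in> L" if "p \<le> r" "s \<in> dyadic" "r < s" for s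
      using p_less[of s] that mono[of _ s] dyadic_range[of s] by force
    moreover have "p \<le> r" if *: "\<forall>s\<in>dyadic. r < s \<longrightarrow> s \<in> L"
    proof (rule ccontr)
      assume "\<not> p \<le> r"
      then obtain q where "q \<in> dyadic" "r < q" "q < p"
        using dyadic_between[of r p] dyadic_range[OF r] p1 by auto
      then show False using * p_less[of q] unfolding p_def
        by (metis IntI UnI1 bdd cInf_lower not_le)
    qed
    ultimately show "p \<in> {0..r} \<longleftrightarrow> (\<forall>s\<in>dyadic. r < s \<longrightarrow> s \<in> L)"
      using p0 by auto
    have "s \<in> U" if s: "r \<le> p" "s \<in> dyadic" "s < r" for s
    proof -
      obtain q where q: "q \<in> dyadic" "s < q" "q < r"
        using dyadic_between[of s r] s dyadic_range[OF r] dyadic_range[of s] by auto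
      then have "q \<notin> L"
        using s(1) bdd unfolding p_def by (metis IntI UnI1 cInf_lower dual_order.trans not_le)
      then show ?thesis using cover[of s q] q s by blast
    qed
    moreover have "r \<le> p" if *: "\<forall>s\<in>dyadic. s < r \<longrightarrow> s \<in> U"
    proof (rule ccontr)
      assume "\<not> r \<le> p"
      then obtain l where l: "l \<in> L" "l \<in> dyadic" "l < r"
        using p_less[of r] dyadic_range[OF r] by auto
      then obtain q where "q \<in> dyadic" "l < q" "q < r"
        using dyadic_between[of l r] dyadic_range[OF r] dyadic_range[of l] by auto
      then show False using * disj[of l q] l by blast
    qed
    ultimately show "p \<in> {r..1} \<longleftrightarrow> (\<forall>s\<in>dyadic. s < r \<longrightarrow> s \<in> U)"
      using p1 by auto
  }
qed

lemma interpreted_struct_exists: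
  fixes V :: "('f, 'c, 'p) vocab" and K :: "('f, 'c, 'q, 'm, bool) struct"
  assumes "positive_interpretation V W K I"
  shows "\<exists>M. interpreted_struct V K I M"
proof -
  define L where "L P b = {s. b \<in> defset K (arity V P) (I P {0..s})}" for P :: 'p and b
  define U where "U P b = {s. b \<in> defset K (arity V P) (I P {s..1})}" for P :: 'p and b
  define p where "p P b = Inf (L P b \<inter> dyadic \<union> {1})" for P :: 'p and b
  have cut: "p P b \<in> {0..1}"
    "r \<in> dyadic \<Longrightarrow> p P b \<in> {0..r} \<longleftrightarrow> (\<forall>s\<in>dyadic. r < s \<longrightarrow> s \<in> L P b)"
    "r \<in> dyadic \<Longrightarrow> p P b \<in> {r..1} \<longleftrightarrow> (\<forall>s\<in>dyadic. s < r \<longrightarrow> s \<in> U P b)"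
    if P: "P \<in> psyms V" "b \<in> tuples (arity V P)" for P b r
  proof -
    have I: "defset K (arity V P) (I P {0..r}) \<subseteq> defset K (arity V P) (I P {0..s})"
      "defset K (arity V P) (I P {0..r}) \<inter> defset K (arity V P) (I P {s..1}) = {}"
      "defset K (arity V P) (I P {r..1}) \<union> defset K (arity V P) (I P {0..s}) = tuples (arity V P)"
      if "r \<in> dyadic" "s \<in> dyadic" "r < s" for r s
      using assms P(1) that unfolding positive_interpretation_def by blast+
    have mono: "s \<in> L P b" if "r \<in> dyadic" "s \<in> dyadic" "r < s" "r \<in> L P b" for r s
      using I(1)[OF that(1-3)] that(4) unfolding L_def by blast
    have disj: "s \<notin> U P b" if "r \<in> dyadic" "s \<in> dyadic" "r < s" "r \<in> L P b" for r s
      using I(2)[OF that(1-3)] that(4) unfolding L_def U_def by blast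
    have cover: "r \<in> U P b \<or> s \<in> L P b" if "r \<in> dyadic" "s \<in> dyadic" "r < s" for r s
      using I(3)[OF that] P(2) unfolding L_def U_def by blast
    show "p P b \<in> {0..1}"
      unfolding p_def by (rule dyadic_cut(1)[where U = "U P b"]) (use mono disj cover in blast)+
    show "p P b \<in> {0..r} \<longleftrightarrow> (\<forall>s\<in>dyadic. r < s \<longrightarrow> s \<in> L P b)" if "r \<in> dyadic"
      unfolding p_def
      by (rule dyadic_cut(2)[where U = "U P b"]) (use mono disj cover that in blast)+
    show "p P b \<in> {r..1} \<longleftrightarrow> (\<forall>s\<in>dyadic. s < r \<longrightarrow> s \<in> U P b)" if "r \<in> dyadic"
      unfolding p_def
      by (rule dyadic_cut(3)[where U = "U P b"]) (use mono disj cover that in blast)+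
  qed
  define M :: "('f, 'c, 'p, 'm, real) struct" where
    "M = \<lparr>cst = restrict (cst K) (csyms V),
          fn = (\<lambda>F\<in>fsyms V. restrict (fn K F) (tuples (farity V F))),
          pr = (\<lambda>P\<in>psyms V. restrict (p P) (tuples (arity V P)))\<rparr>"
  have "is_general_struct V M"
    using cut(1) by (auto simp: is_struct_def M_def)
  then have "interpreted_struct V K I M"
    unfolding interpreted_struct_def using cut(2,3) by (auto simp: M_def L_def U_def)
  then show ?thesis by blast
qed

lemma interpreted_struct_unique:
  assumes M: "interpreted_struct V K I M" and N: "interpreted_struct V K I N"
  shows "M = N"
proof -
  have struct: "is_general_struct V M" "is_general_struct V N"
    using M N by (auto simp: interpreted_struct_def)
  note fn_mem = struct[unfolded is_struct_def, THEN conjunct2, THEN conjunct1]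
  note pr_mem = struct[unfolded is_struct_def, THEN conjunct2, THEN conjunct2]
  have K: "\<forall>c\<in>csyms V. cst X c = cst K c"
    "\<forall>F\<in>fsyms V. \<forall>b\<in>tuples (farity V F). fn X F b = fn K F b"
    "\<forall>P\<in>psyms V. \<forall>r\<in>dyadic. \<forall>b\<in>tuples (arity V P).
       pr X P b \<in> {0..r} \<longleftrightarrow> (\<forall>s\<in>dyadic. r < s \<longrightarrow> b \<in> defset K (arity V P) (I P {0..s}))"
    if "interpreted_struct V K I X" for X
    using that unfolding interpreted_struct_def by blast+
  have "cst M c = cst N c" if "c \<in> csyms V" for c
    using K(1)[OF M] K(1)[OF N] that by simp
  then have "cst M = cst N"
    using struct unfolding is_struct_def by (blast intro: PiE_ext)
  moreover have "fn M F b = fn N F b" if "F \<in> fsyms V" "b \<in> tuples (farity V F)" for F b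
    using K(2)[OF M] K(2)[OF N] that by simp
  then have "fn M = fn N"
    by (intro PiE_ext[OF fn_mem] PiE_ext[OF PiE_mem[OF fn_mem(1)] PiE_mem[OF fn_mem(2)]])
  moreover have "pr M P b = pr N P b" if P: "P \<in> psyms V" "b \<in> tuples (arity V P)" for P b
  proof -
    have r: "pr M P b \<in> {0..1}" "pr N P b \<in> {0..1}"
      using struct P by (auto simp: is_struct_def PiE_iff)
    have "pr M P b \<in> {0..r} \<longleftrightarrow> pr N P b \<in> {0..r}" if "r \<in> dyadic" for r
      by (simp only: K(3)[OF M, rule_format, OF P(1) that P(2)]
          K(3)[OF N, rule_format, OF P(1) that P(2)])
    then have le: "pr M P b \<le> r \<longleftrightarrow> pr N P b \<le> r" if "r \<in> dyadic" for r
      using r that by auto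
    have "pr M P b \<le> pr N P b"
      by (subst dyadic_le_iff) (use r le in auto)
    moreover have "pr N P b \<le> pr M P b"
      by (subst dyadic_le_iff) (use r le in auto)
    ultimately show ?thesis by simp
  qed
  then have "pr M = pr N"
    by (intro PiE_ext[OF pr_mem] PiE_ext[OF PiE_mem[OF pr_mem(1)] PiE_mem[OF pr_mem(2)]])
  ultimately show ?thesis by (simp add: struct.equality)
qed

section \<open>Continuity of the values of formulas\<close>

definition interpretation_params ::
  "('f, 'c, 'p) vocab \<Rightarrow> ('p \<Rightarrow> real set \<Rightarrow> ('g, 'd, 'q, 'm) fo set) \<Rightarrow> 'm set" where
  "interpretation_params V I = (\<Union>P\<in>psyms V. \<Union>J\<in>dyadic_intervals. \<Union>\<theta>\<in>I P J. fo_params \<theta>)"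

lemma finite_tm_params: "finite (tm_params t)"
  by (induction t) auto

lemma finite_fo_params: "finite (fo_params \<phi>)"
  by (induction \<phi>) (auto simp: finite_tm_params)

lemma countable_interpretation_params:
  assumes "countable (psyms V)" "positive_interpretation V W K I"
  shows "countable (interpretation_params V I)"
proof -
  have "countable dyadic_intervals"
    unfolding dyadic_intervals_def using countable_dyadic by auto
  moreover have "countable (I P J)" if "P \<in> psyms V" "J \<in> dyadic_intervals" for P J
    using assms(2) that unfolding positive_interpretation_def wedge_formula_def by blast
  ultimately show ?thesis
    unfolding interpretation_params_def using assms(1)
    by (intro countable_UN) (auto simp: finite_fo_params countable_finite)
qed

locale interpretation_context = positive_context \<upsilon> W K A
  for \<upsilon> :: "'u rel" and W :: "('f, 'c, 'q) vocab" and K :: "('f, 'c, 'q, 'm, bool) struct"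
    and A :: "'m set" +
  fixes V :: "('f, 'c, 'p) vocab" and I :: "'p \<Rightarrow> real set \<Rightarrow> ('f, 'c, 'q, 'm) fo set"
    and M :: "('f, 'c, 'p, 'm, real) struct"
  assumes csyms: "csyms V \<subseteq> csyms W" and fsyms: "fsyms V \<subseteq> fsyms W"
    and farity: "\<forall>F\<in>fsyms V. farity V F = farity W F"
    and I: "positive_interpretation V W K I"
    and M: "interpreted_struct V K I M"
    and params: "interpretation_params V I \<subseteq> A"
begin

lemma general_M: "is_general_struct V M"
  using M by (simp add: interpreted_struct_def)

lemma tm_wf_W: "tm_wf V t \<Longrightarrow> tm_wf W t"
  using csyms fsyms farity by (induction t) auto

lemma tm_val_M: "tm_wf V t \<Longrightarrow> tm_val M e \<sigma> t = tm_val K e \<sigma> t"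
proof (induction t)
  case (App F ts)
  then have "map (tm_val M e \<sigma>) ts = map (tm_val K e \<sigma>) ts" by simp
  then have "tm_val M e \<sigma> (App F ts) = fn M F (map (tm_val K e \<sigma>) ts)"
    by (simp only: tm_val.simps)
  also have "\<dots> = fn K F (map (tm_val K e \<sigma>) ts)"
    using App.prems M unfolding interpreted_struct_def by (simp add: tuples_def)
  finally show ?case by simp
qed (use M in \<open>auto simp: interpreted_struct_def\<close>)

lemma closedin_defset:
  assumes "P \<in> psyms V" "J \<in> dyadic_intervals" "length ts = arity V P"
    and "\<And>t. t \<in> set ts \<Longrightarrow> tm_wf V t \<and> tm_params t \<subseteq> A"
  shows "closedin T {\<sigma>. map (tm_val K id \<sigma>) ts \<in> defset K (arity V P) (I P J)}"
proof -
  have wedge: "wedge_formula W (arity V P) (I P J)"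
    using I assms(1,2) unfolding positive_interpretation_def by blast
  have "closedin T {\<sigma>. sat K id (\<lambda>i. map (tm_val K id \<sigma>) ts ! i) \<theta>}" if \<theta>: "\<theta> \<in> I P J" for \<theta>
  proof (rule closedin_sat_subst)
    have "fo_params \<theta> \<subseteq> A"
      using params assms(1,2) \<theta> unfolding interpretation_params_def by blast
    then show "\<theta> \<in> pos_fms W A"
      using wedge \<theta> unfolding wedge_formula_def pos_fms_def by blast
    show "fo_fv \<theta> \<subseteq> {..<length ts}"
      using wedge \<theta> assms(3) unfolding wedge_formula_def by simp
  qed (use assms(4) tm_wf_W in blast)
  then have "closedin T {\<sigma>. \<forall>\<theta>. \<theta> \<in> I P J \<longrightarrow> sat K id (\<lambda>i. map (tm_val K id \<sigma>) ts ! i) \<theta>}"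
    by (intro closedin_T_all closedin_T_imp)
  then show ?thesis
    using assms(3) by (simp add: defset_def tuples_def Ball_def)
qed

lemma continuous_map_dyadic:
  assumes f: "\<And>\<sigma>. f \<sigma> \<in> {0..1}"
    and le: "\<And>r. r \<in> dyadic \<Longrightarrow> closedin T {\<sigma>. f \<sigma> \<le> r}"
    and ge: "\<And>r. r \<in> dyadic \<Longrightarrow> closedin T {\<sigma>. r \<le> f \<sigma>}"
  shows "continuous_map T euclideanreal f"
proof -
  have "closedin T {\<sigma>. f \<sigma> \<le> a}" for a
  proof (cases "0 \<le> a")
    case True
    have "closedin T {\<sigma>. \<forall>q. q \<in> dyadic \<longrightarrow> a \<le> q \<longrightarrow> f \<sigma> \<le> q}"
      by (intro closedin_T_all closedin_T_imp le)
    then show ?thesis using dyadic_le_iff[OF f True] by (simp add: Ball_def)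
  next
    case False
    then have "\<not> f \<sigma> \<le> a" for \<sigma> using f[of \<sigma>] by auto
    then show ?thesis by simp
  qed
  moreover have "closedin T {\<sigma>. a \<le> f \<sigma>}" for a
  proof (cases "a \<le> 1")
    case True
    have "closedin T {\<sigma>. \<forall>q. q \<in> dyadic \<longrightarrow> q \<le> a \<longrightarrow> q \<le> f \<sigma>}"
      by (intro closedin_T_all closedin_T_imp ge)
    then show ?thesis using dyadic_ge_iff[OF f True] by (simp add: Ball_def)
  next
    case False
    then have "\<not> a \<le> f \<sigma>" for \<sigma> using f[of \<sigma>] by auto
    then show ?thesis by simp
  qed
  ultimately show ?thesis
    by (simp add: continuous_map_upper_lower_semicontinuous_le topspace_T)
qed

lemma continuous_map_Pred:
  assumes "fm_wf V (Pred P ts)" "fm_params (Pred P ts) \<subseteq> A"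
  shows "continuous_map T euclideanreal (\<lambda>\<sigma>. val M id \<sigma> (Pred P ts))"
proof -
  define b where "b = (\<lambda>\<sigma>. map (tm_val K id \<sigma>) ts)"
  have P: "P \<in> psyms V" "length ts = arity V P"
    and ts: "\<And>t. t \<in> set ts \<Longrightarrow> tm_wf V t \<and> tm_params t \<subseteq> A"
    using assms by auto
  have b: "b \<sigma> \<in> tuples (arity V P)" for \<sigma>
    using P by (simp add: b_def tuples_def)
  have range: "pr M P (b \<sigma>) \<in> {0..1}" for \<sigma>
    using general_M P b by (auto simp: is_struct_def PiE_iff)
  have cut: "pr M P (b \<sigma>) \<in> {0..r} \<longleftrightarrow>
        (\<forall>s\<in>dyadic. r < s \<longrightarrow> b \<sigma> \<in> defset K (arity V P) (I P {0..s}))"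
      "pr M P (b \<sigma>) \<in> {r..1} \<longleftrightarrow>
        (\<forall>s\<in>dyadic. s < r \<longrightarrow> b \<sigma> \<in> defset K (arity V P) (I P {s..1}))"
    if "r \<in> dyadic" for r \<sigma>
    using M P b that unfolding interpreted_struct_def by blast+
  have closed: "closedin T {\<sigma>. b \<sigma> \<in> defset K (arity V P) (I P J)}"
    if "J \<in> dyadic_intervals" for J
    unfolding b_def using closedin_defset P ts that by blast
  have "continuous_map T euclideanreal (\<lambda>\<sigma>. pr M P (b \<sigma>))"
  proof (rule continuous_map_dyadic[OF range])
    fix r assume r: "r \<in> dyadic"
    have "pr M P (b \<sigma>) \<le> r \<longleftrightarrow>
        (\<forall>s. s \<in> dyadic \<longrightarrow> r < s \<longrightarrow> b \<sigma> \<in> defset K (arity V P) (I P {0..s}))" for \<sigma>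
      using cut(1)[OF r, of \<sigma>] range[of \<sigma>] by auto
    then show "closedin T {\<sigma>. pr M P (b \<sigma>) \<le> r}"
      by (simp only:) (intro closedin_T_all closedin_T_imp closed dyadic_intervals_memI)
    have "r \<le> pr M P (b \<sigma>) \<longleftrightarrow>
        (\<forall>s. s \<in> dyadic \<longrightarrow> s < r \<longrightarrow> b \<sigma> \<in> defset K (arity V P) (I P {s..1}))" for \<sigma>
      using cut(2)[OF r, of \<sigma>] range[of \<sigma>] by auto
    then show "closedin T {\<sigma>. r \<le> pr M P (b \<sigma>)}"
      by (simp only:) (intro closedin_T_all closedin_T_imp closed dyadic_intervals_memI)
  qed
  moreover have "val M id \<sigma> (Pred P ts) = pr M P (b \<sigma>)" for \<sigma>
    using ts by (auto simp: b_def tm_val_M intro!: arg_cong[where f = "pr M P"])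
  ultimately show ?thesis by simp
qed

lemma continuous_map_val:
  "fm_wf V \<phi> \<Longrightarrow> fm_params \<phi> \<subseteq> A \<Longrightarrow> continuous_map T euclideanreal (\<lambda>\<sigma>. val M id \<sigma> \<phi>)"
proof (induction \<phi>)
  case (Pred P ts)
  then show ?case by (rule continuous_map_Pred)
next
  case (Conn C \<phi>s)
  let ?X = "product_topology (\<lambda>_. top_of_set {0..1::real}) {..<length \<phi>s}"
  let ?v = "\<lambda>\<sigma>. \<lambda>i\<in>{..<length \<phi>s}. map (val M id \<sigma>) \<phi>s ! i"
  have "continuous_map T (top_of_set {0..1}) (\<lambda>\<sigma>. ?v \<sigma> i)" if "i < length \<phi>s" for i
  proof -
    have mem: "\<phi>s ! i \<in> set \<phi>s" using that by simp
    then have i: "fm_wf V (\<phi>s ! i)" "fm_params (\<phi>s ! i) \<subseteq> A"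
      using Conn.prems by auto
    note Conn.IH[OF mem i]
    then show ?thesis
      using that val_range[OF general_M i(1)] by (auto simp: continuous_map_in_subtopology id_def)
  qed
  then have "continuous_map T ?X ?v"
    by (auto simp: continuous_map_componentwise)
  moreover have "continuous_map ?X (top_of_set {0..1}) C"
    using Conn.prems by (simp add: connective_def)
  ultimately have "continuous_map T (top_of_set {0..1}) (C \<circ> ?v)"
    by (rule continuous_map_compose)
  then show ?case
    by (simp add: continuous_map_in_subtopology comp_def id_def)
next
  case (SupQ x \<phi>)
  have range: "val M id \<sigma> \<phi> \<in> {0..1}" for \<sigma>
    by (rule val_range[OF general_M]) (use SupQ.prems in simp)
  have "continuous_map T euclideanreal (\<lambda>\<sigma>. val M id \<sigma> \<phi>)"
    by (rule SupQ.IH) (use SupQ.prems in simp_all)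
  then have "continuous_map T euclideanreal (\<lambda>\<sigma>. SUP a. val M id (\<sigma>(x := a)) \<phi>)"
    by (rule continuous_map_SUP[where c = 1]) (use range in \<open>simp add: id_def\<close>)
  then show ?case by (simp only: val.simps)
next
  case (InfQ x \<phi>)
  have range: "val M id \<sigma> \<phi> \<in> {0..1}" for \<sigma>
    by (rule val_range[OF general_M]) (use InfQ.prems in simp)
  have "continuous_map T euclideanreal (\<lambda>\<sigma>. val M id \<sigma> \<phi>)"
    by (rule InfQ.IH) (use InfQ.prems in simp_all)
  then have "continuous_map T euclideanreal (\<lambda>\<sigma>. INF a. val M id (\<sigma>(x := a)) \<phi>)"
    by (rule continuous_map_INF[where c = 0]) (use range in \<open>simp add: id_def\<close>)
  then show ?case by (simp only: val.simps)
qed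

text \<open>
  The zero set is a preimage under a continuous map, hence closed; one-variable formulas are
  evaluated at constant assignments.
\<close>

lemma zero_set_positively_definable:
  assumes "\<phi> \<in> fms1 V A"
  shows "\<exists>\<Theta>\<subseteq>pos_fms W A. (\<forall>\<theta>\<in>\<Theta>. fo_fv \<theta> \<subseteq> {0}) \<and>
    (\<forall>b. val M id (\<lambda>_. b) \<phi> = 0 \<longleftrightarrow> (\<forall>\<theta>\<in>\<Theta>. sat K id (\<lambda>_. b) \<theta>))"
proof -
  have "continuous_map T euclideanreal (\<lambda>\<sigma>. val M id \<sigma> \<phi>)"
    using assms by (simp add: fms1_def continuous_map_val)
  then have "closedin T {\<sigma>. val M id \<sigma> \<phi> \<in> {0}}"
    using closedin_continuous_map_preimage[of T euclideanreal _ "{0}"] by (simp add: topspace_T)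
  then obtain \<Theta> where "\<Theta> \<subseteq> pos_fms W A" "\<And>\<theta>. \<theta> \<in> \<Theta> \<Longrightarrow> fo_fv \<theta> \<subseteq> {0}"
    "\<And>b. (\<lambda>_. b) \<in> {\<sigma>. val M id \<sigma> \<phi> \<in> {0}} \<longleftrightarrow> (\<forall>\<theta>\<in>\<Theta>. sat K id (\<lambda>_. b) \<theta>)"
    using closedin_diagonal by blast
  then show ?thesis by (intro exI[of _ \<Theta>]) simp
qed

lemma saturated_over:
  assumes \<Phi>: "\<Phi> \<subseteq> fms1 V A"
    and fin: "\<And>\<Psi>. \<Psi> \<subseteq> \<Phi> \<Longrightarrow> finite \<Psi> \<Longrightarrow> \<exists>b. \<forall>\<phi>\<in>\<Psi>. val M id (\<lambda>_. b) \<phi> = 0"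
  shows "\<exists>b. \<forall>\<phi>\<in>\<Phi>. val M id (\<lambda>_. b) \<phi> = 0"
proof -
  have "\<forall>\<phi>\<in>\<Phi>. \<exists>\<Theta>. \<Theta> \<subseteq> pos_fms W A \<and> (\<forall>\<theta>\<in>\<Theta>. fo_fv \<theta> \<subseteq> {0}) \<and>
      (\<forall>b. val M id (\<lambda>_. b) \<phi> = 0 \<longleftrightarrow> (\<forall>\<theta>\<in>\<Theta>. sat K id (\<lambda>_. b) \<theta>))"
    using zero_set_positively_definable \<Phi> by blast
  from bchoice[OF this] obtain \<Theta> where \<Theta>: "\<forall>\<phi>\<in>\<Phi>. \<Theta> \<phi> \<subseteq> pos_fms W A \<and> (\<forall>\<theta>\<in>\<Theta> \<phi>. fo_fv \<theta> \<subseteq> {0}) \<and>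
      (\<forall>b. val M id (\<lambda>_. b) \<phi> = 0 \<longleftrightarrow> (\<forall>\<theta>\<in>\<Theta> \<phi>. sat K id (\<lambda>_. b) \<theta>))" ..
  have zero: "val M id (\<lambda>_. b) \<phi> = 0 \<longleftrightarrow> (\<forall>\<theta>\<in>\<Theta> \<phi>. sat K id (\<lambda>_. b) \<theta>)" if "\<phi> \<in> \<Phi>" for \<phi> b
    using bspec[OF \<Theta> that] by (elim conjE allE)
  have pos: "\<theta> \<in> pos_fms W A \<and> fo_fv \<theta> \<subseteq> {0}" if "\<phi> \<in> \<Phi>" "\<theta> \<in> \<Theta> \<phi>" for \<phi> \<theta>
    using bspec[OF \<Theta> that(1)] that(2) by (elim conjE) blast
  let ?\<Theta> = "\<Union>\<phi>\<in>\<Phi>. \<Theta> \<phi>"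
  have "\<exists>b. \<forall>\<theta>\<in>\<Psi>. sat K id (\<lambda>_. b) \<theta>" if \<Psi>: "\<Psi> \<subseteq> ?\<Theta>" "finite \<Psi>" for \<Psi>
  proof -
    obtain \<Phi>' where \<Phi>': "\<Phi>' \<subseteq> \<Phi>" "finite \<Phi>'" "\<Psi> \<subseteq> (\<Union>\<phi>\<in>\<Phi>'. \<Theta> \<phi>)"
      using finite_subset_Union[OF \<Psi>(2,1)] by (metis finite_subset_image)
    then obtain b where b: "\<forall>\<phi>\<in>\<Phi>'. val M id (\<lambda>_. b) \<phi> = 0"
      using fin by blast
    have "sat K id (\<lambda>_. b) \<theta>" if \<theta>: "\<theta> \<in> \<Psi>" for \<theta>
    proof -
      obtain \<phi> where "\<phi> \<in> \<Phi>'" "\<theta> \<in> \<Theta> \<phi>" using \<Phi>'(3) \<theta> by blast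
      then show ?thesis using b zero[of \<phi> b] \<Phi>'(1) by blast
    qed
    then show ?thesis by blast
  qed
  moreover have "\<forall>\<theta>\<in>?\<Theta>. fo_wf W \<theta> \<and> positive \<theta> \<and> fo_fv \<theta> \<subseteq> {0}"
    using pos by (fastforce simp: pos_fms_def)
  moreover have "(\<Union>\<theta>\<in>?\<Theta>. fo_params \<theta>) \<subseteq> A"
    using pos by (fastforce simp: pos_fms_def)
  then have "|\<Union>\<theta>\<in>?\<Theta>. fo_params \<theta>| <o \<upsilon>"
    using small by (meson card_of_mono1 ordLeq_ordLess_trans)
  ultimately have "\<exists>b. \<forall>\<theta>\<in>?\<Theta>. sat K id (\<lambda>_. b) \<theta>"
    using saturated_K[unfolded positively_saturated_def, rule_format, of ?\<Theta>] by blast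
  then show ?thesis by (simp add: zero)
qed

lemma positive_type_determines_tp:
  assumes "positive_type W K A b = positive_type W K A c"
  shows "tp V M id A b = tp V M id A c"
proof -
  have "val M id (\<lambda>_. b) \<phi> = 0 \<longleftrightarrow> val M id (\<lambda>_. c) \<phi> = 0" if \<phi>: "\<phi> \<in> fms1 V A" for \<phi>
  proof -
    obtain \<Theta> where \<Theta>: "\<Theta> \<subseteq> pos_fms W A \<and> (\<forall>\<theta>\<in>\<Theta>. fo_fv \<theta> \<subseteq> {0}) \<and>
      (\<forall>b. val M id (\<lambda>_. b) \<phi> = 0 \<longleftrightarrow> (\<forall>\<theta>\<in>\<Theta>. sat K id (\<lambda>_. b) \<theta>))"
      using zero_set_positively_definable[OF \<phi>] ..
    have "sat K id (\<lambda>_. a) \<theta> \<longleftrightarrow> \<theta> \<in> positive_type W K A a" if "\<theta> \<in> \<Theta>" for a \<theta>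
      using that \<Theta> by (auto simp: positive_type_def pos_fms_def)
    then show ?thesis using \<Theta> assms by simp
  qed
  then show ?thesis unfolding tp_def by blast
qed

end

section \<open>Saturation and stability of the interpreted structure\<close>

lemma card_of_range_factor:
  assumes "\<And>a b. f a = f b \<Longrightarrow> g a = g b"
  shows "|range g| \<le>o |range f|"
proof -
  have "g a = g (inv f (f a))" for a
    by (rule assms) (simp add: f_inv_into_f)
  then have "range g = (\<lambda>y. g (inv f y)) ` range f"
    unfolding image_image by (rule image_cong[OF refl])
  then show ?thesis by (simp only: card_of_image)
qed

text \<open>
  Positive \<open>\<lambda>\<close>-stability counts types over sets of cardinality exactly \<open>\<lambda>\<close>, whereas
  \<open>\<lambda>\<close>-stability is about sets of at most that cardinality; those have to be enlarged, which the
  universe permits if it has at least \<open>\<lambda>\<close> elements.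
\<close>

lemma enlarge_to_card:
  fixes A :: "'m set" and l :: "'l rel"
  assumes "Cinfinite l" "|A| \<le>o l" "l \<le>o |UNIV :: 'm set|"
  obtains B where "A \<subseteq> B" "|B| =o l"
proof -
  have l: "|Field l| =o l" using assms(1) card_of_Field_ordIso by blast
  then have "|Field l| \<le>o |UNIV :: 'm set|"
    using assms(3) ordIso_ordLeq_trans by blast
  then obtain S :: "'m set" where S: "|Field l| =o |S|"
    by (metis internalize_card_of_ordLeq2)
  then have Sl: "|S| =o l" using l ordIso_symmetric ordIso_transitive by blast
  have "|A \<union> S| \<le>o l"
    using assms(1,2) ordIso_imp_ordLeq[OF Sl]
    by (intro card_of_Un_ordLeq_infinite_Field) (auto simp: cinfinite_def)
  moreover have "l \<le>o |A \<union> S|"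
    using Sl card_of_mono1[of S "A \<union> S"] by (meson Un_upper2 ordIso_ordLeq_trans ordIso_symmetric)
  ultimately show ?thesis
    using that[of "A \<union> S"] ordIso_iff_ordLeq by blast
qed

text \<open>
  The set of types realized in \<open>M\<close> itself is the witness: its realizations are all elements, so
  they are trivially dense.
\<close>

lemma lambda_stable_all_realized:
  assumes "is_general_struct V M"
    and "\<And>A :: 'm set. |A| <o \<upsilon> \<Longrightarrow> |A| \<le>o l \<Longrightarrow> |range (tp V M id A)| \<le>o l"
  shows "lambda_stable \<upsilon> l V (M :: ('f, 'c, 'p, 'm, real) struct)"
  unfolding lambda_stable_def
proof (intro allI impI)
  fix A :: "'m set"
  assume A: "|A| <o \<upsilon> \<and> |A| \<le>o l"
  have "tp V M id A b \<in> types1 V M A" for b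
    unfolding types1_def using assms(1)
    by (intro CollectI exI[of _ M] exI[of _ id] exI[of _ b]) (auto simp: theory_of_def)
  then show "\<exists>B\<subseteq>types1 V M A. |B| \<le>o l \<and>
      struct_topology V M closure_of {b. tp V M id A b \<in> B} = topspace (struct_topology V M)"
    using assms(2) A
    by (intro exI[of _ "range (tp V M id A)"]) (auto simp: closure_of_topspace closure_of_UNIV)
qed

theorem theorem4p10p1:
  fixes V :: "('f, 'c, 'p) vocab"
    and W :: "('f, 'c, 'q) vocab"
    and \<upsilon> :: "'u rel"
    and K :: "('f, 'c, 'q, 'm, bool) struct"
    and I :: "'p \<Rightarrow> real set \<Rightarrow> ('f, 'c, 'q, 'm) fo set"
  assumes "countable (psyms V)" and "countable (fsyms V)"
    and "inaccessible \<upsilon>" and "|symbols V| <o \<upsilon>"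
    and "csyms V \<subseteq> csyms W" and "fsyms V \<subseteq> fsyms W"
    and "\<forall>F\<in>fsyms V. farity V F = farity W F"
    and "positive_monster \<upsilon> W K"
    and "positive_interpretation V W K I"
  shows "(\<exists>!M. interpreted_struct V K I M) \<and>
    (\<forall>M. interpreted_struct V K I M \<longrightarrow>
       saturated \<upsilon> V M \<and> |UNIV :: 'm set| =o \<upsilon> \<and>
       (is_reduced V M \<longrightarrow> monster \<upsilon> V M) \<and>
       (\<forall>l :: 'l rel. Cinfinite l \<and> positively_stable \<upsilon> l W K \<longrightarrow> lambda_stable \<upsilon> l V M))"
proof -
  let ?A\<^sub>0 = "interpretation_params V I"
  have card_order: "Card_order \<upsilon>" and uncountable: "natLeq <o \<upsilon>"
    using assms(3) by (auto simp: inaccessible_def)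
  have K: "positively_saturated \<upsilon> W K" and card: "|UNIV :: 'm set| =o \<upsilon>"
    using assms(8) by (auto simp: positive_monster_def)
  have inf_\<upsilon>: "infinite (Field \<upsilon>)"
    using uncountable by (rule infinite_Field)
  have inf_UNIV: "infinite (UNIV :: 'm set)"
    using card cinfinite_mono[OF ordIso_imp_ordLeq[OF ordIso_symmetric[OF card]]] inf_\<upsilon>
    by (auto simp: cinfinite_def Field_card_of)
  have "|?A\<^sub>0| \<le>o |UNIV :: nat set|"
    using inj_on_to_nat_on[OF countable_interpretation_params[OF assms(1,9)]]
    by (rule card_of_ordLeqI) simp
  then have A\<^sub>0: "|?A\<^sub>0| \<le>o natLeq"
    using card_of_nat by (rule ordLeq_ordIso_trans)
  have ctxt: "interpretation_context \<upsilon> W K A V I M"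
    if "interpreted_struct V K I M" "?A\<^sub>0 \<subseteq> A" "|A| <o \<upsilon>" for A M
    by unfold_locales (use assms K card_order uncountable inf_UNIV that in auto)
  have small: "|A \<union> ?A\<^sub>0| <o \<upsilon>" if "|A| <o \<upsilon>" for A
    using inf_\<upsilon> card_order that ordLeq_ordLess_trans[OF A\<^sub>0 uncountable]
    by (rule card_of_Un_ordLess_infinite_Field)
  have sat: "saturated \<upsilon> V M" if M: "interpreted_struct V K I M" for M
    unfolding saturated_def
  proof (intro allI impI)
    fix A :: "'m set" and \<Phi> :: "('f, 'c, 'p, 'm) fm set"
    assume A: "|A| <o \<upsilon>" and \<Phi>: "\<Phi> \<subseteq> fms1 V A"
      and fin: "\<forall>\<Psi>\<subseteq>\<Phi>. finite \<Psi> \<longrightarrow> (\<exists>b. \<forall>\<phi>\<in>\<Psi>. val M id (\<lambda>_. b) \<phi> = 0)"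
    have "\<Phi> \<subseteq> fms1 V (A \<union> ?A\<^sub>0)"
      using \<Phi> by (auto simp: fms1_def)
    then show "\<exists>b. \<forall>\<phi>\<in>\<Phi>. val M id (\<lambda>_. b) \<phi> = 0"
      using interpretation_context.saturated_over[OF ctxt[OF M Un_upper2 small[OF A]]] fin by blast
  qed
  have stable: "lambda_stable \<upsilon> l V M"
    if M: "interpreted_struct V K I M" and l: "Cinfinite l" and st: "positively_stable \<upsilon> l W K"
    for M and l :: "'l rel"
  proof (rule lambda_stable_all_realized)
    show "is_general_struct V M"
      using M by (simp add: interpreted_struct_def)
    fix A :: "'m set"
    assume A: "|A| <o \<upsilon>" "|A| \<le>o l"
    show "|range (tp V M id A)| \<le>o l"
    proof (cases "\<upsilon> \<le>o l")
      case True
      \<comment> \<open>there are at most as many realized types as elements\<close>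
      then show ?thesis
        using card_of_image[of "tp V M id A" UNIV] card
        by (meson ordIso_imp_ordLeq ordLeq_transitive)
    next
      case False
      then have l_less: "l <o \<upsilon>"
        using l card_order by (simp add: card_order_on_well_order_on not_ordLeq_iff_ordLess)
      have "|A \<union> ?A\<^sub>0| \<le>o l"
        using l A(2) ordLeq_transitive[OF A\<^sub>0] natLeq_ordLeq_cinfinite[OF l]
        by (intro card_of_Un_ordLeq_infinite_Field) (auto simp: cinfinite_def)
      moreover have "l \<le>o |UNIV :: 'm set|"
        using l_less card by (meson ordIso_symmetric ordLess_imp_ordLeq ordLeq_ordIso_trans)
      ultimately obtain B where B: "A \<union> ?A\<^sub>0 \<subseteq> B" "|B| =o l"
        using enlarge_to_card[OF l] by blast
      then interpret interpretation_context \<upsilon> W K B V I M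
        using ctxt[OF M] ordIso_ordLess_trans[OF B(2) l_less] by blast
      have "tp V M id A b = tp V M id B b \<inter> fms1 V A" for b
        using B(1) by (auto simp: tp_def fms1_def)
      then have "|range (tp V M id A)| \<le>o |range (positive_type W K B)|"
        using positive_type_determines_tp by (intro card_of_range_factor) metis
      then show ?thesis
        using st B(2) unfolding positively_stable_def by (meson ordLeq_transitive)
    qed
  qed
  show ?thesis
  proof (intro conjI allI impI)
    show "\<exists>!M. interpreted_struct V K I M"
      using interpreted_struct_exists[OF assms(9)] interpreted_struct_unique by (rule ex_ex1I)
    fix M
    assume M: "interpreted_struct V K I M"
    show "saturated \<upsilon> V M" by (rule sat[OF M])
    show "|UNIV :: 'm set| =o \<upsilon>" by (rule card)
    show "monster \<upsilon> V M" if "is_reduced V M"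
      using M that sat[OF M] card unfolding monster_def interpreted_struct_def by blast
    show "lambda_stable \<upsilon> l V M" if "Cinfinite l \<and> positively_stable \<upsilon> l W K" for l :: "'l rel"
      using stable[OF M] that by blast
  qed
qed

end
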